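(* Let $\mathcal{A}\mathsf{gd}^{¡}$ be the Koszul dual cooperad of the AsGDer operad $\mathcal{A}\mathsf{gd}$. Then for all $n\ge1$ $$\mathcal{A}\mathsf{gd}^{¡}(n)=\Bbbk\mu^c_n\oplus\Bbbk h^c_n\oplus\Bbbk\delta^c_n$$ with $|\mu^c_n|=n-1$ and $|h^c_n|=|\delta^c_n|=n$; the counit $\varepsilon$ is given by $\varepsilon(\mu^c_1)=\mathbf 1\in\mathcal{I}$; and the infinitesimal decomposition is given by $$\Delta_{(1)}(\mu^c_n)=\sum_{p+q+r=n}(-1)^{r(q-1)}\mu^c_{p+r+1}\boxtimes_{p+1}\mu^c_q,$$ $$\Delta_{(1)}(h^c_n)=\sum_{p+q+r=n}(-1)^{r(q-1)}\mu^c_{p+r+1}\boxtimes_{p+1}h^c_q+\sum_{p+q+r=n}(-1)^{(r+1)(q-1)}h^c_{p+r+1}\boxtimes_{p+1}\mu^c_q,$$ $$\Delta_{(1)}(\delta^c_n)=\sum_{p+q+r=n}(-1)^{(r+1)(q-1)}\delta^c_{p+r+1}\boxtimes_{p+1}\mu^c_q+\sum_{q+r=n}(-1)^{r(q-1)}\mu^c_{r+1}\boxtimes_1\delta^c_q+\sum_{\substack{p+q+r=n\\ p\ge1}}(-1)^{r(q-1)}\mu^c_{p+r+1}\boxtimes_{p+1}h^c_q,$$ where all sums run over $p,r\ge 0$ and $q\ge 1$ (with $p\geq 1$ where indicated).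
   Context: $\Bbbk$ is a field of characteristic zero. All (co)operads are $\Bbbk$-linear, nonsymmetric (ns), graded, and reduced (zero in arity $0$). Koszul sign conventions are used; descriptions of (co)operads are up to isomorphism. $\mathcal{I}$ is the unit $\mathbb{N}$-module, $\mathcal{I}(1)=\Bbbk\mathbf 1$ and $\mathcal{I}(n)=0$ for $n\neq1$. The AsGDer operad $\mathcal{A}\mathsf{gd}=\mathcal{F}(E)/(R)$ is the ns quadratic operad with generators $E(1)=\Bbbk h\oplus\Bbbk\delta$, $E(2)=\Bbbk\mu$, $E(n)=0$ for $n\ne 1,2$ (all in degree $0$), where $\mathcal{F}(E)$ is the free ns operad on $E$ and $(R)$ is the operadic ideal generated by the space $R\subset\mathcal{F}(E)^{(2)}$ spanned by $$\mu\circ_1\mu-\mu\circ_2\mu,\qquad h\circ_1\mu-\mu\circ_1h-\mu\circ_2h,\qquad \delta\circ_1\mu-\mu\circ_1\delta-\mu\circ_2h.$$ For a quadratic ns operad $\mathcal{P}=\mathcal{F}(E)/(R)$, the Koszul dual cooperad is $\mathcal{P}^{¡}=\mathcal{C}(sE,s^2R)$, where $s$ raises degree by $1$ and $\mathcal{C}(sE,s^2R)$ is the quadratic cooperad, i.e. the universal sub-cooperad $\mathcal{C}$ of the cofree conilpotent cooperad $\mathcal{F}^c(sE)$ such that the composite $\mathcal{C}\hookrightarrow\mathcal{F}^c(sE)\twoheadrightarrow\mathcal{F}^c(sE)^{(2)}/s^2R$ is zero. For a ns cooperad $(\mathcal{C},\Delta,\varepsilon)$, the infinitesimal decomposition map $\Delta_{(1)}\colon\mathcal{C}\to\mathcal{C}\circ(\mathcal{I},\mathcal{C})$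 is the composite of $\Delta\colon\mathcal{C}\to\mathcal{C}\circ\mathcal{C}$ with the map that singles out one of the upper factors (summing over all choices) and applies $\varepsilon$ to all the other upper factors. For $\alpha\in\mathcal{C}(k)$, $\beta\in\mathcal{C}(m)$ one writes $\alpha\boxtimes_i\beta=\alpha\otimes(\mathbf 1^{\otimes i-1}\otimes\beta\otimes\mathbf 1^{\otimes k-i})$. *)

theory Defs
  imports Complex_Main "HOL-Library.Poly_Mapping"
begin

section \<open>Vector spaces with a chosen basis\<close>

text \<open>The space with basis \<open>'b\<close> over the field \<open>'k\<close> is the type of finitely supported functions
  \<open>'b \<Rightarrow>\<^sub>0 'k\<close>.\<close>

definition scl :: "'k::field \<Rightarrow> ('b \<Rightarrow>\<^sub>0 'k) \<Rightarrow> ('b \<Rightarrow>\<^sub>0 'k)" where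
  "scl c = Poly_Mapping.map ((*) c)"

lemma lookup_scl [simp]: "Poly_Mapping.lookup (scl c x) b = c * Poly_Mapping.lookup x b"
  by (simp add: scl_def Poly_Mapping.map.rep_eq when_def)

interpretation scl: vector_space scl
  by unfold_locales (auto intro!: poly_mapping_eqI simp: lookup_add algebra_simps)

text \<open>Linear and bilinear extension of a map given on basis elements.\<close>

definition lin :: "('b \<Rightarrow> ('c \<Rightarrow>\<^sub>0 'k::field)) \<Rightarrow> ('b \<Rightarrow>\<^sub>0 'k) \<Rightarrow> ('c \<Rightarrow>\<^sub>0 'k)" where
  "lin f x = (\<Sum>b\<in>Poly_Mapping.keys x. scl (Poly_Mapping.lookup x b) (f b))"

definition bilin ::
    "('a \<Rightarrow> 'b \<Rightarrow> ('c \<Rightarrow>\<^sub>0 'k::field)) \<Rightarrow> ('a \<Rightarrow>\<^sub>0 'k) \<Rightarrow> ('b \<Rightarrow>\<^sub>0 'k) \<Rightarrow> ('c \<Rightarrow>\<^sub>0 'k)" where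
  "bilin f x y = lin (\<lambda>a. lin (f a) y) x"

abbreviation bas :: "'b \<Rightarrow> ('b \<Rightarrow>\<^sub>0 'k::field)" where
  "bas b \<equiv> Poly_Mapping.single b 1"

definition part :: "('b \<Rightarrow> bool) \<Rightarrow> ('b \<Rightarrow>\<^sub>0 'k::field) \<Rightarrow> ('b \<Rightarrow>\<^sub>0 'k)" where
  "part P = lin (\<lambda>b. if P b then bas b else 0)"

fun tensor_list :: "('b \<Rightarrow>\<^sub>0 'k::field) list \<Rightarrow> ('b list \<Rightarrow>\<^sub>0 'k)" where
  "tensor_list [] = bas []"
| "tensor_list (x # xs) = bilin (\<lambda>b bs. bas (b # bs)) x (tensor_list xs)"

definition sgn_pow :: "int \<Rightarrow> 'k::field" where
  "sgn_pow d = (if even d then 1 else - 1)"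


section \<open>Tree monomials\<close>

text \<open>The graded \<open>\<nat>\<close>-module of generators is given by a homogeneous basis \<open>'g\<close>, with arities \<open>ar\<close>
  and degrees \<open>dg\<close>. A planar tree with vertices labelled by \<open>'g\<close> stands for the tensor product of
  its labels in preorder (root first, then the subtrees from left to right). All Koszul signs below
  refer to this order.\<close>

datatype 'g tree = Leaf | Node 'g "'g tree list"

fun wf_tree :: "('g \<Rightarrow> nat) \<Rightarrow> 'g tree \<Rightarrow> bool" where
  "wf_tree ar Leaf = True"
| "wf_tree ar (Node g ts) = (length ts = ar g \<and> (\<forall>t\<in>set ts. wf_tree ar t))"

fun leaves :: "'g tree \<Rightarrow> nat" where
  "leaves Leaf = 1"
| "leaves (Node g ts) = sum_list (map leaves ts)"

fun weight :: "'g tree \<Rightarrow> nat" where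
  "weight Leaf = 0"
| "weight (Node g ts) = Suc (sum_list (map weight ts))"

fun tdeg :: "('g \<Rightarrow> int) \<Rightarrow> 'g tree \<Rightarrow> int" where
  "tdeg dg Leaf = 0"
| "tdeg dg (Node g ts) = dg g + sum_list (map (tdeg dg) ts)"

text \<open>The tree module: the arity \<open>n\<close> part underlying both the free operad and the cofree
  conilpotent cooperad.\<close>

definition tree_mod :: "('g \<Rightarrow> nat) \<Rightarrow> nat \<Rightarrow> ('g tree \<Rightarrow>\<^sub>0 'k::field) set" where
  "tree_mod ar n = {x. \<forall>t\<in>Poly_Mapping.keys x. wf_tree ar t \<and> leaves t = n}"

definition homogeneous :: "('g \<Rightarrow> int) \<Rightarrow> int \<Rightarrow> ('g tree \<Rightarrow>\<^sub>0 'k::field) \<Rightarrow> bool" where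
  "homogeneous dg d x \<longleftrightarrow> (\<forall>t\<in>Poly_Mapping.keys x. tdeg dg t = d)"


section \<open>The free ns operad and quadratic operads\<close>

text \<open>Grafting \<open>s\<close> onto the \<open>i\<close>-th leaf of a tree; leaves are numbered from 1.\<close>

fun graft :: "'g tree \<Rightarrow> nat \<Rightarrow> 'g tree \<Rightarrow> 'g tree"
  and graft_list :: "'g tree list \<Rightarrow> nat \<Rightarrow> 'g tree \<Rightarrow> 'g tree list" where
  "graft Leaf i s = s"
| "graft (Node g ts) i s = Node g (graft_list ts i s)"
| "graft_list [] i s = []"
| "graft_list (t # ts) i s =
     (if i \<le> leaves t then graft t i s # ts else t # graft_list ts (i - leaves t) s)"

text \<open>Total degree of the vertices after the \<open>i\<close>-th leaf in preorder: the labels that those of the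
  grafted tree have to move past.\<close>

fun deg_after :: "('g \<Rightarrow> int) \<Rightarrow> 'g tree \<Rightarrow> nat \<Rightarrow> int"
  and deg_after_list :: "('g \<Rightarrow> int) \<Rightarrow> 'g tree list \<Rightarrow> nat \<Rightarrow> int" where
  "deg_after dg Leaf i = 0"
| "deg_after dg (Node g ts) i = deg_after_list dg ts i"
| "deg_after_list dg [] i = 0"
| "deg_after_list dg (t # ts) i =
     (if i \<le> leaves t then deg_after dg t i + sum_list (map (tdeg dg) ts)
      else deg_after_list dg ts (i - leaves t))"

definition pcomp ::
    "('g \<Rightarrow> int) \<Rightarrow> ('g tree \<Rightarrow>\<^sub>0 'k::field) \<Rightarrow> nat \<Rightarrow> ('g tree \<Rightarrow>\<^sub>0 'k) \<Rightarrow> ('g tree \<Rightarrow>\<^sub>0 'k)" where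
  "pcomp dg x i y =
     bilin (\<lambda>t s. scl (sgn_pow (deg_after dg t i * tdeg dg s)) (bas (graft t i s))) x y"

definition corolla :: "('g \<Rightarrow> nat) \<Rightarrow> 'g \<Rightarrow> ('g tree \<Rightarrow>\<^sub>0 'k::field)" where
  "corolla ar g = bas (Node g (replicate (ar g) Leaf))"

text \<open>A quadratic presentation \<open>(E, R)\<close>. The relations form a subspace spanned by elements of
  weight two that are homogeneous for arity and degree.\<close>

record (overloaded) ('g, 'k) quadratic_data =
  arity :: "'g \<Rightarrow> nat"
  degree :: "'g \<Rightarrow> int"
  relations :: "('g tree \<Rightarrow>\<^sub>0 'k) set"

inductive in_operadic_ideal ::
    "('g, 'k::field) quadratic_data \<Rightarrow> nat \<Rightarrow> ('g tree \<Rightarrow>\<^sub>0 'k) \<Rightarrow> bool" for Q where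
  relation: "r \<in> relations Q \<Longrightarrow> r \<in> tree_mod (arity Q) n \<Longrightarrow> in_operadic_ideal Q n r"
| zero: "in_operadic_ideal Q n 0"
| add: "in_operadic_ideal Q n x \<Longrightarrow> in_operadic_ideal Q n y \<Longrightarrow> in_operadic_ideal Q n (x + y)"
| scale: "in_operadic_ideal Q n x \<Longrightarrow> in_operadic_ideal Q n (scl c x)"
| comp_left: "in_operadic_ideal Q m x \<Longrightarrow> y \<in> tree_mod (arity Q) k \<Longrightarrow> 1 \<le> i \<Longrightarrow> i \<le> m \<Longrightarrow>
    in_operadic_ideal Q (m + k - 1) (pcomp (degree Q) x i y)"
| comp_right: "x \<in> tree_mod (arity Q) m \<Longrightarrow> in_operadic_ideal Q k y \<Longrightarrow> 1 \<le> i \<Longrightarrow> i \<le> m \<Longrightarrow>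
    in_operadic_ideal Q (m + k - 1) (pcomp (degree Q) x i y)"

text \<open>The arity \<open>n\<close> part of \<open>\<F>(E)/(R)\<close>.\<close>

definition quadratic_operad ::
    "('g, 'k::field) quadratic_data \<Rightarrow> nat \<Rightarrow> ('g tree \<Rightarrow>\<^sub>0 'k) set set" where
  "quadratic_operad Q n = tree_mod (arity Q) n //
     {(x, y). x \<in> tree_mod (arity Q) n \<and> y \<in> tree_mod (arity Q) n \<and> in_operadic_ideal Q n (x - y)}"


section \<open>The cofree conilpotent ns cooperad\<close>

text \<open>A basis element \<open>(t, [s\<^sub>1, \<dots>, s\<^sub>k])\<close> stands for \<open>t \<otimes> (s\<^sub>1 \<otimes> \<dots> \<otimes> s\<^sub>k)\<close> in the composite
  product \<open>\<circ>\<close> of tree modules; \<open>t\<close> is the lower (root) factor.\<close>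

text \<open>The Koszul sign of the reordering
  \<open>u\<^sub>1 \<otimes> V\<^sub>1 \<otimes> \<dots> \<otimes> u\<^sub>k \<otimes> V\<^sub>k \<mapsto> u\<^sub>1 \<otimes> \<dots> \<otimes> u\<^sub>k \<otimes> V\<^sub>1 \<otimes> \<dots> \<otimes> V\<^sub>k\<close>.\<close>

fun shuffle_sign :: "('g \<Rightarrow> int) \<Rightarrow> ('g tree \<times> 'g tree list) list \<Rightarrow> 'k::field" where
  "shuffle_sign dg [] = 1"
| "shuffle_sign dg ((u, vs) # ps) =
     sgn_pow (sum_list (map (tdeg dg) vs) * sum_list (map (tdeg dg \<circ> fst) ps)) * shuffle_sign dg ps"

text \<open>The decomposition map on tree monomials, i.e. the sum over all ways of cutting a tree into a
  lower tree and a forest of upper trees. Either nothing lies below the cut, or the lower tree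
  contains the root and the subtrees above the root are cut independently.\<close>

fun tree_decomp :: "('g \<Rightarrow> int) \<Rightarrow> 'g tree \<Rightarrow> ('g tree \<times> 'g tree list \<Rightarrow>\<^sub>0 'k::field)" where
  "tree_decomp dg Leaf = bas (Leaf, [Leaf])"
| "tree_decomp dg (Node g ts) =
     bas (Leaf, [Node g ts]) +
     lin (\<lambda>ps. scl (shuffle_sign dg ps) (bas (Node g (map fst ps), concat (map snd ps))))
       (tensor_list (map (tree_decomp dg) ts))"

definition decomp ::
    "('g \<Rightarrow> int) \<Rightarrow> ('g tree \<Rightarrow>\<^sub>0 'k::field) \<Rightarrow> ('g tree \<times> 'g tree list \<Rightarrow>\<^sub>0 'k)" where
  "decomp dg = lin (tree_decomp dg)"

text \<open>The counit, with \<open>\<I>(1) = \<k>\<one>\<close> identified with \<open>\<k>\<close>. It vanishes outside arity one.\<close>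

definition counit :: "('g tree \<Rightarrow>\<^sub>0 'k::field) \<Rightarrow> 'k" where
  "counit x = Poly_Mapping.lookup x Leaf"

text \<open>A basis element \<open>(t, i, s)\<close> stands for \<open>t \<boxtimes>\<^sub>i s\<close>.\<close>

definition boxtimes ::
    "('g tree \<Rightarrow>\<^sub>0 'k::field) \<Rightarrow> nat \<Rightarrow> ('g tree \<Rightarrow>\<^sub>0 'k) \<Rightarrow> ('g tree \<times> nat \<times> 'g tree \<Rightarrow>\<^sub>0 'k)"
  ("_ \<boxtimes>\<^bsub>_\<^esub> _" [76, 0, 76] 75) where
  "a \<boxtimes>\<^bsub>i\<^esub> b = bilin (\<lambda>t s. bas (t, i, s)) a b"

definition single_out ::
    "'g tree \<times> 'g tree list \<Rightarrow> ('g tree \<times> nat \<times> 'g tree \<Rightarrow>\<^sub>0 'k::field)" where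
  "single_out = (\<lambda>(t, ss). \<Sum>i<length ss.
     scl (\<Prod>j\<in>{..<length ss} - {i}. counit (bas (ss ! j))) (bas (t, Suc i, ss ! i)))"

definition inf_decomp ::
    "('g \<Rightarrow> int) \<Rightarrow> ('g tree \<Rightarrow>\<^sub>0 'k::field) \<Rightarrow> ('g tree \<times> nat \<times> 'g tree \<Rightarrow>\<^sub>0 'k)" where
  "inf_decomp dg x = lin single_out (decomp dg x)"


section \<open>Quadratic cooperads and the Koszul dual cooperad\<close>

definition elem_tensor ::
    "('g tree \<Rightarrow>\<^sub>0 'k::field) \<Rightarrow> ('g tree \<Rightarrow>\<^sub>0 'k) list \<Rightarrow> ('g tree \<times> 'g tree list \<Rightarrow>\<^sub>0 'k)" where
  "elem_tensor a bs = bilin (\<lambda>t ss. bas (t, ss)) a (tensor_list bs)"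

text \<open>The arity \<open>n\<close> part of \<open>C \<circ> C\<close> inside the composite product of the tree module with itself.\<close>

definition comp_prod ::
    "(nat \<Rightarrow> ('g tree \<Rightarrow>\<^sub>0 'k::field) set) \<Rightarrow> nat \<Rightarrow> ('g tree \<times> 'g tree list \<Rightarrow>\<^sub>0 'k) set" where
  "comp_prod C n = scl.span {elem_tensor a bs | a bs ms.
     a \<in> C (length bs) \<and> list_all2 (\<lambda>b m. b \<in> C m) bs ms \<and> sum_list ms = n}"

definition sub_cooperad ::
    "('g \<Rightarrow> nat) \<Rightarrow> ('g \<Rightarrow> int) \<Rightarrow> (nat \<Rightarrow> ('g tree \<Rightarrow>\<^sub>0 'k::field) set) \<Rightarrow> bool" where
  "sub_cooperad ar dg C \<longleftrightarrow> (\<forall>n.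
     scl.subspace (C n) \<and> C n \<subseteq> tree_mod ar n \<and>
     (\<forall>x\<in>C n. \<forall>d. part (\<lambda>t. tdeg dg t = d) x \<in> C n) \<and>
     (\<forall>x\<in>C n. decomp dg x \<in> comp_prod C n))"

text \<open>The composite of \<open>C \<hookrightarrow> \<F>\<^sup>c(V)\<close> with \<open>\<F>\<^sup>c(V) \<rightarrow> \<F>\<^sup>c(V)\<^sup>(\<^sup>2\<^sup>)/S\<close> is zero.\<close>

definition corelations_hold ::
    "('g tree \<Rightarrow>\<^sub>0 'k::field) set \<Rightarrow> (nat \<Rightarrow> ('g tree \<Rightarrow>\<^sub>0 'k) set) \<Rightarrow> bool" where
  "corelations_hold S C \<longleftrightarrow> (\<forall>n. \<forall>x\<in>C n. part (\<lambda>t. weight t = 2) x \<in> S)"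

definition is_quadratic_cooperad ::
    "('g \<Rightarrow> nat) \<Rightarrow> ('g \<Rightarrow> int) \<Rightarrow> ('g tree \<Rightarrow>\<^sub>0 'k::field) set \<Rightarrow>
      (nat \<Rightarrow> ('g tree \<Rightarrow>\<^sub>0 'k) set) \<Rightarrow> bool" where
  "is_quadratic_cooperad ar dg S C \<longleftrightarrow>
     sub_cooperad ar dg C \<and> corelations_hold S C \<and>
     (\<forall>D. sub_cooperad ar dg D \<longrightarrow> corelations_hold S D \<longrightarrow> (\<forall>n. D n \<subseteq> C n))"

definition quadratic_cooperad ::
    "('g \<Rightarrow> nat) \<Rightarrow> ('g \<Rightarrow> int) \<Rightarrow> ('g tree \<Rightarrow>\<^sub>0 'k::field) set \<Rightarrow>
      nat \<Rightarrow> ('g tree \<Rightarrow>\<^sub>0 'k) set" where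
  "quadratic_cooperad ar dg S = (THE C. is_quadratic_cooperad ar dg S C)"

lemma lin_superset:
  assumes "finite A" "Poly_Mapping.keys x \<subseteq> A"
  shows "lin f x = (\<Sum>b\<in>A. scl (Poly_Mapping.lookup x b) (f b))"
  unfolding lin_def
  by (rule sum.mono_neutral_left[OF assms]) (auto simp: in_keys_iff)

lemma lin_add: "lin f (x + y) = lin f x + lin f y"
proof -
  let ?A = "Poly_Mapping.keys x \<union> Poly_Mapping.keys y"
  have "Poly_Mapping.keys (x + y) \<subseteq> ?A"
    by (rule keys_add)
  then show ?thesis
    by (simp add: lin_superset[of ?A] lookup_add scl.scale_left_distrib sum.distrib)
qed

lemma lin_scl: "lin f (scl c x) = scl c (lin f x)"
proof -
  have "Poly_Mapping.keys (scl c x) \<subseteq> Poly_Mapping.keys x"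
    by (auto simp: in_keys_iff)
  then show ?thesis
    by (simp add: lin_superset[of "Poly_Mapping.keys x"] scl.scale_sum_right)
qed

lemma lin_0 [simp]: "lin f 0 = 0"
  by (simp add: lin_def)

lemma lin_subspace_preimage:
  assumes "scl.subspace S"
  shows "scl.subspace {x. lin f x \<in> S}"
  using assms
  by (auto simp: scl.subspace_def lin_add lin_scl)

lemma subspace_tree_mod: "scl.subspace (tree_mod ar n)"
  unfolding scl.subspace_def tree_mod_def
  using keys_add by (fastforce simp: in_keys_iff)

lemma comp_prod_mono:
  assumes "\<And>n. C n \<subseteq> D n"
  shows "comp_prod C n \<subseteq> comp_prod D n"
  unfolding comp_prod_def
proof (rule scl.span_mono, safe)
  fix a bs ms
  assume "a \<in> C (length bs)" "list_all2 (\<lambda>b m. b \<in> C m) bs ms"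
  moreover from this have "list_all2 (\<lambda>b m. b \<in> D m) bs ms"
    using assms by (auto elim!: list_all2_mono)
  ultimately show "\<exists>a' bs' ms'. elem_tensor a bs = elem_tensor a' bs' \<and> a' \<in> D (length bs') \<and>
      list_all2 (\<lambda>b m. b \<in> D m) bs' ms' \<and> sum_list ms' = sum_list ms"
    using assms by blast
qed

text \<open>The universal sub-cooperad exists (as the sum of all sub-cooperads on which the corelations
  hold) and is unique, so the definite description above is meaningful.\<close>

lemma ex1_quadratic_cooperad:
  assumes S: "scl.subspace S"
  shows "\<exists>!C. is_quadratic_cooperad ar dg S C"
proof -
  define F where "F = {D. sub_cooperad ar dg D \<and> corelations_hold S D}"
  define C where "C n = scl.span (\<Union>D\<in>F. D n)" for n
  have up: "D n \<subseteq> C n" if "D \<in> F" for D n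
    using that unfolding C_def by (auto intro: scl.span_base)
  have span_in: "C n \<subseteq> T"
    if "scl.subspace T" "\<And>D x. D \<in> F \<Longrightarrow> x \<in> D n \<Longrightarrow> x \<in> T" for n T
    unfolding C_def using that by (intro scl.span_minimal) auto
  have sub_C: "scl.subspace (C n)" for n
    by (simp add: C_def)
  have "C n \<subseteq> tree_mod ar n" for n
    by (rule span_in[OF subspace_tree_mod]) (auto simp: F_def sub_cooperad_def)
  moreover have "C n \<subseteq> {x. part (\<lambda>t. tdeg dg t = d) x \<in> C n}" for n d
    unfolding part_def
  proof (rule span_in[OF lin_subspace_preimage[OF sub_C]])
    fix D x assume "D \<in> F" "x \<in> D n"
    then show "x \<in> {x. lin (\<lambda>b. if tdeg dg b = d then bas b else 0) x \<in> C n}"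
      using up[of D n] by (auto simp: F_def sub_cooperad_def part_def)
  qed
  moreover have "C n \<subseteq> {x. decomp dg x \<in> comp_prod C n}" for n
    unfolding decomp_def
  proof (rule span_in[OF lin_subspace_preimage])
    show "scl.subspace (comp_prod C n)"
      by (simp add: comp_prod_def)
    fix D x assume D: "D \<in> F" "x \<in> D n"
    then show "x \<in> {x. lin (tree_decomp dg) x \<in> comp_prod C n}"
      using comp_prod_mono[of D C n, OF up[OF D(1)]]
      by (auto simp: F_def sub_cooperad_def decomp_def)
  qed
  moreover have "C n \<subseteq> {x. part (\<lambda>t. weight t = 2) x \<in> S}" for n
    unfolding part_def
    by (rule span_in[OF lin_subspace_preimage[OF S]])
      (auto simp: F_def corelations_hold_def part_def)
  ultimately have "is_quadratic_cooperad ar dg S C"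
    using sub_C up
    unfolding is_quadratic_cooperad_def sub_cooperad_def[of ar dg C] corelations_hold_def[of S C] F_def
    by blast
  moreover have "C' = C''"
    if "is_quadratic_cooperad ar dg S C'" "is_quadratic_cooperad ar dg S C''" for C' C''
    using that unfolding is_quadratic_cooperad_def by (intro ext) blast
  ultimately show ?thesis
    by blast
qed

text \<open>The map \<open>s\<^sup>2\<close> from \<open>\<F>(E)\<^sup>(\<^sup>2\<^sup>)\<close> to \<open>\<F>(sE)\<^sup>(\<^sup>2\<^sup>)\<close>, which applies \<open>s \<otimes> s\<close> to the two vertices;
  \<open>sE\<close> has the same basis \<open>'g\<close> as \<open>E\<close>, in degrees raised by one. Moving the second \<open>s\<close> past the
  root label gives the sign.\<close>

definition suspend2 :: "('g \<Rightarrow> int) \<Rightarrow> ('g tree \<Rightarrow>\<^sub>0 'k::field) \<Rightarrow> ('g tree \<Rightarrow>\<^sub>0 'k)" where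
  "suspend2 dg = lin (\<lambda>t. case t of Leaf \<Rightarrow> 0 | Node g ts \<Rightarrow> scl (sgn_pow (dg g)) (bas t))"

definition susp_degree :: "('g \<Rightarrow> int) \<Rightarrow> 'g \<Rightarrow> int" where
  "susp_degree dg g = dg g + 1"

definition koszul_dual :: "('g, 'k::field) quadratic_data \<Rightarrow> nat \<Rightarrow> ('g tree \<Rightarrow>\<^sub>0 'k) set" where
  "koszul_dual Q =
     quadratic_cooperad (arity Q) (susp_degree (degree Q)) (suspend2 (degree Q) ` relations Q)"


section \<open>The AsGDer operad\<close>

datatype agd_gen = GH | GD | GM

fun agd_arity :: "agd_gen \<Rightarrow> nat" where
  "agd_arity GH = 1"
| "agd_arity GD = 1"
| "agd_arity GM = 2"

definition agd_degree :: "agd_gen \<Rightarrow> int" where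
  "agd_degree g = 0"

definition agd_relations :: "(agd_gen tree \<Rightarrow>\<^sub>0 'k::field) set" where
  "agd_relations =
     (let h = corolla agd_arity GH; \<delta> = corolla agd_arity GD; \<mu> = corolla agd_arity GM;
          comp = pcomp agd_degree
      in scl.span
        {comp \<mu> 1 \<mu> - comp \<mu> 2 \<mu>,
         comp h 1 \<mu> - comp \<mu> 1 h - comp \<mu> 2 h,
         comp \<delta> 1 \<mu> - comp \<mu> 1 \<delta> - comp \<mu> 2 h})"

definition agd :: "(agd_gen, 'k::field) quadratic_data" where
  "agd = \<lparr>arity = agd_arity, degree = agd_degree, relations = agd_relations\<rparr>"

text \<open>For the Koszul dual of \<open>agd\<close> the definite description denotes the universal sub-cooperad.\<close>

lemma koszul_dual_agd:
  "is_quadratic_cooperad agd_arity (susp_degree agd_degree)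
     (suspend2 agd_degree ` agd_relations) (koszul_dual (agd :: (agd_gen, 'k::field) quadratic_data))"
proof -
  have "scl.subspace (suspend2 agd_degree ` agd_relations :: (agd_gen tree \<Rightarrow>\<^sub>0 'k) set)"
  proof -
    have "scl.subspace (lin f ` (agd_relations :: (agd_gen tree \<Rightarrow>\<^sub>0 'k) set))"
      for f :: "agd_gen tree \<Rightarrow> (agd_gen tree \<Rightarrow>\<^sub>0 'k)"
    proof -
      have R: "scl.subspace (agd_relations :: (agd_gen tree \<Rightarrow>\<^sub>0 'k) set)"
        by (simp add: agd_relations_def Let_def)
      show ?thesis
        unfolding scl.subspace_def
      proof (intro conjI ballI allI)
        show "0 \<in> lin f ` agd_relations"
          using scl.subspace_0[OF R] by (metis imageI lin_0)
        show "x + y \<in> lin f ` agd_relations"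
          if "x \<in> lin f ` agd_relations" "y \<in> lin f ` agd_relations" for x y
          using that scl.subspace_add[OF R] by (auto simp: lin_add[symmetric])
        show "scl c x \<in> lin f ` agd_relations" if "x \<in> lin f ` agd_relations" for c x
          using that scl.subspace_scale[OF R] by (auto simp: lin_scl[symmetric])
      qed
    qed
    then show ?thesis
      by (simp add: suspend2_def)
  qed
  from theI'[OF ex1_quadratic_cooperad[OF this]] show ?thesis
    by (simp add: koszul_dual_def quadratic_cooperad_def agd_def)
qed

end

theory Submission
  imports Defs
begin

text \<open>The elements \<open>\<mu> n\<close>, \<open>h n\<close>, \<open>\<delta> n\<close> are given by explicit coefficients on trees. The first one is the
  signed sum of all planar binary trees with \<open>n\<close> leaves. For the second one, insert one vertex
  labelled \<open>h\<close> at an arbitrary edge, leaves and root included. For the third one, the inserted vertex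
  is labelled \<open>\<delta>\<close> if its edge lies on the leftmost branch, and \<open>h\<close> otherwise. The coefficient of a
  grafted tree is a combination of products of coefficients of its two parts, which is the formula
  for the infinitesimal decomposition; iterating it over a forest shows that the three families span
  a sub-cooperad, hence lie in the Koszul dual by universality.

  Conversely, a sub-cooperad is closed under slicing its decomposition, i.e. fixing all but one
  tensor factor. Slices transport the corelations to the root of a tree with arbitrary subtrees on
  top, and these relations show that an element vanishes as soon as it vanishes on the right comb and
  on the right comb with one unary vertex below the root. So the Koszul dual has dimension at most
  three in each arity.\<close>

section \<open>Coefficients of linear extensions\<close>

abbreviation coef :: "('b \<Rightarrow>\<^sub>0 'k::zero) \<Rightarrow> 'b \<Rightarrow> 'k" where
  "coef \<equiv> Poly_Mapping.lookup"

lemma lookup_lin: "coef (lin f x) b = (\<Sum>a\<in>Poly_Mapping.keys x. coef x a * coef (f a) b)"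
  by (simp add: lin_def lookup_sum)

text \<open>Most maps below send at most one basis element of the support to a multiple of a given
  one. The source \<open>a0\<close> may lie outside the support, where both sides are 0, so no case
  distinction is needed at the uses.\<close>

lemma lookup_lin_unique:
  assumes "\<And>a. a \<in> Poly_Mapping.keys x \<Longrightarrow> coef (f a) b \<noteq> 0 \<Longrightarrow> a = a0"
  shows "coef (lin f x) b = coef x a0 * coef (f a0) b"
proof (cases "a0 \<in> Poly_Mapping.keys x")
  case True
  have "coef (lin f x) b = (\<Sum>a\<in>{a0}. coef x a * coef (f a) b)"
    unfolding lookup_lin by (rule sum.mono_neutral_right) (use assms True in auto)
  then show ?thesis by simp
next
  case False
  then have "coef (lin f x) b = 0"
    unfolding lookup_lin by (intro sum.neutral) (use assms in force)
  with False show ?thesis by (simp add: in_keys_iff)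
qed

lemma lookup_lin_eq_0:
  assumes "\<And>a. a \<in> Poly_Mapping.keys x \<Longrightarrow> coef (f a) b = 0"
  shows "coef (lin f x) b = 0"
  unfolding lookup_lin by (intro sum.neutral) (use assms in auto)

lemma lookup_bas: "coef (bas a) b = (if a = b then 1 else 0)"
  by (simp add: lookup_single when_def)

lemma lookup_bilin_bas:
  assumes "\<And>a b a' b'. f a b = f a' b' \<Longrightarrow> a = a' \<and> b = b'"
  shows "coef (bilin (\<lambda>a b. bas (f a b)) x y) (f a b) = coef x a * coef y b"
proof -
  have *: "coef (lin (\<lambda>b. bas (f a' b)) y) (f a b) = (if a' = a then coef y b else 0)" for a'
    by (subst lookup_lin_unique[where ?a0.0 = b]) (use assms in \<open>auto simp: lookup_bas split: if_splits\<close>)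
  show ?thesis
    unfolding bilin_def
    by (subst lookup_lin_unique[where ?a0.0 = a]) (auto simp: * split: if_splits)
qed

lemma lookup_bilin_bas_eq_0:
  assumes "\<And>a b. f a b \<noteq> z"
  shows "coef (bilin (\<lambda>a b. bas (f a b)) x y) z = 0"
  unfolding bilin_def by (intro lookup_lin_eq_0) (use assms in \<open>auto simp: lookup_bas\<close>)

lemma lookup_tensor_list:
  "coef (tensor_list xs) bs =
     (if length bs = length xs then prod_list (map2 coef xs bs) else 0)"
proof (induction xs arbitrary: bs)
  case Nil
  then show ?case by (auto simp: lookup_bas)
next
  case (Cons x xs)
  show ?case
  proof (cases bs)
    case Nil
    then show ?thesis by (simp add: lookup_bilin_bas_eq_0)
  next
    case (Cons b bs')
    then show ?thesis
      using lookup_bilin_bas[of "(#)" x "tensor_list xs" b bs'] Cons.IH by auto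
  qed
qed

lemma lookup_elem_tensor:
  "coef (elem_tensor a bs) (t, ss) =
     (if length ss = length bs then coef a t * prod_list (map2 coef bs ss) else 0)"
  using lookup_bilin_bas[of Pair a "tensor_list bs" t ss]
  by (simp add: elem_tensor_def lookup_tensor_list)

lemma lookup_boxtimes: "coef (a \<boxtimes>\<^bsub>i\<^esub> b) (t, j, s) = (if i = j then coef a t * coef b s else 0)"
  using lookup_bilin_bas[of "\<lambda>t s. (t, i, s)" a b t s]
    lookup_bilin_bas_eq_0[of "\<lambda>t s. (t, i, s)" "(t, j, s)" a b]
  by (auto simp: boxtimes_def)

lemma lookup_part: "coef (part P x) t = (if P t then coef x t else 0)"
  unfolding part_def
  by (subst lookup_lin_unique[where ?a0.0 = t]) (auto simp: lookup_bas split: if_splits)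

lemma sgn_pow_add: "sgn_pow (a + b) = sgn_pow a * (sgn_pow b :: 'k::field)"
  by (auto simp: sgn_pow_def)

lemma sgn_pow_0 [simp]: "sgn_pow 0 = 1"
  by (simp add: sgn_pow_def)

lemma sgn_pow_nonzero [simp]: "sgn_pow a \<noteq> (0 :: 'k::field)"
  by (simp add: sgn_pow_def)


section \<open>Decomposition and grafting\<close>

text \<open>The inverse of a cut: the forest is put on all leaves of the lower tree at once. It is
  meant for \<open>length ss = leaves t\<close>, in which case \<open>hd\<close> at a leaf meets a
  list of length one.\<close>

fun full_graft :: "'g tree \<Rightarrow> 'g tree list \<Rightarrow> 'g tree"
  and full_graft_list :: "'g tree list \<Rightarrow> 'g tree list \<Rightarrow> 'g tree list" where
  "full_graft Leaf ss = hd ss"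
| "full_graft (Node g ts) ss = Node g (full_graft_list ts ss)"
| "full_graft_list [] ss = []"
| "full_graft_list (t # ts) ss =
     full_graft t (take (leaves t) ss) # full_graft_list ts (drop (leaves t) ss)"

text \<open>The product of all factors \<open>shuffle_sign\<close> met by the recursion of
  \<open>tree_decomp\<close>: the upper trees over a subtree of the lower tree move past the later
  siblings of that subtree.\<close>

fun cut_sign :: "('g \<Rightarrow> int) \<Rightarrow> 'g tree \<Rightarrow> 'g tree list \<Rightarrow> 'k::field"
  and cut_sign_list :: "('g \<Rightarrow> int) \<Rightarrow> 'g tree list \<Rightarrow> 'g tree list \<Rightarrow> 'k" where
  "cut_sign dg Leaf ss = 1"
| "cut_sign dg (Node g ts) ss = cut_sign_list dg ts ss"
| "cut_sign_list dg [] ss = 1"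
| "cut_sign_list dg (t # ts) ss =
     sgn_pow (sum_list (map (tdeg dg) (take (leaves t) ss)) * sum_list (map (tdeg dg) ts)) *
     cut_sign dg t (take (leaves t) ss) * cut_sign_list dg ts (drop (leaves t) ss)"

fun split_forest :: "'g tree list \<Rightarrow> 'g tree list \<Rightarrow> ('g tree \<times> 'g tree list) list" where
  "split_forest [] ss = []"
| "split_forest (t # ts) ss = (t, take (leaves t) ss) # split_forest ts (drop (leaves t) ss)"

lemma map_fst_split_forest [simp]: "map fst (split_forest ts ss) = ts"
  by (induction ts arbitrary: ss) auto

lemma map_comp_fst_split_forest [simp]: "map (f \<circ> fst) (split_forest ts ss) = map f ts"
  by (metis map_fst_split_forest map_map)

lemma length_split_forest [simp]: "length (split_forest ts ss) = length ts"
  by (induction ts arbitrary: ss) auto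

lemma concat_split_forest:
  "length ss = sum_list (map leaves ts) \<Longrightarrow> concat (map snd (split_forest ts ss)) = ss"
  by (induction ts arbitrary: ss) auto

lemma split_forest_unique:
  "list_all (\<lambda>(t, vs). length vs = leaves t) ps \<Longrightarrow>
     split_forest (map fst ps) (concat (map snd ps)) = ps"
  by (induction ps) auto

lemma length_concat_forest:
  "list_all (\<lambda>(t, vs). length vs = leaves t) ps \<Longrightarrow>
     length (concat (map snd ps)) = sum_list (map leaves (map fst ps))"
  by (induction ps) auto

text \<open>The step of \<open>lookup_tree_decomp\<close> from the children to the root. The first
  assumption is the induction hypothesis for the children \<open>ts\<close>; the shuffle sign
  supplies the missing factors of \<open>cut_sign_list\<close>.\<close>

lemma lookup_tensor_split:
  assumes "\<And>t' t ss. t' \<in> set ts \<Longrightarrow> coef (tree_decomp dg t') (t, ss) =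
      (if length ss = leaves t \<and> full_graft t ss = t' then cut_sign dg t ss else 0 :: 'k::field)"
    and "length ss = sum_list (map leaves us)"
  shows "coef (tensor_list (map (tree_decomp dg) ts)) (split_forest us ss) *
      shuffle_sign dg (split_forest us ss) =
    (if full_graft_list us ss = ts then cut_sign_list dg us ss else 0 :: 'k)"
  using assms
proof (induction us arbitrary: ts ss)
  case Nil
  then show ?case by (auto simp: lookup_tensor_list)
next
  case (Cons u us)
  show ?case
  proof (cases ts)
    case Nil
    then show ?thesis by (simp add: lookup_bas)
  next
    case (Cons t' ts')
    have "coef (tensor_list (map (tree_decomp dg) ts')) (split_forest us (drop (leaves u) ss)) *
      shuffle_sign dg (split_forest us (drop (leaves u) ss)) =
      (if full_graft_list us (drop (leaves u) ss) = ts'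
       then cut_sign_list dg us (drop (leaves u) ss) else 0 :: 'k)"
      using Cons.prems by (intro Cons.IH) (auto simp: \<open>ts = t' # ts'\<close>)
    moreover have "coef (tree_decomp dg t') (u, take (leaves u) ss) =
      (if full_graft u (take (leaves u) ss) = t' then cut_sign dg u (take (leaves u) ss) else 0 :: 'k)"
      using Cons.prems by (subst Cons.prems(1)) (auto simp: \<open>ts = t' # ts'\<close>)
    ultimately show ?thesis
      by (auto simp: lookup_tensor_list \<open>ts = t' # ts'\<close>
          simp del: tensor_list.simps split: if_splits)
  qed
qed

text \<open>A lower tree and a forest of matching length come from exactly one cut of exactly one
  tree, the grafted one, so each coefficient is a single sign or 0.\<close>

lemma lookup_tree_decomp:
  "coef (tree_decomp dg t') (t, ss) =
     (if length ss = leaves t \<and> full_graft t ss = t' then cut_sign dg t ss else 0 :: 'k::field)"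
proof (induction t' arbitrary: t ss)
  case Leaf
  show ?case
  proof (cases t)
    case Leaf
    then show ?thesis by (cases ss) (auto simp: lookup_bas)
  qed (auto simp: lookup_bas)
next
  case (Node g ts)
  define f :: "('a tree \<times> 'a tree list) list \<Rightarrow> ('a tree \<times> 'a tree list \<Rightarrow>\<^sub>0 'k)" where
    "f = (\<lambda>ps. scl (shuffle_sign dg ps) (bas (Node g (map fst ps), concat (map snd ps))))"
  define y :: "('a tree \<times> 'a tree list) list \<Rightarrow>\<^sub>0 'k" where
    "y = tensor_list (map (tree_decomp dg) ts)"
  have dec: "tree_decomp dg (Node g ts) = bas (Leaf, [Node g ts]) + lin f y"
    by (simp add: f_def y_def)
  have keys_y: "list_all (\<lambda>(t, vs). length vs = leaves t) ps" if "ps \<in> Poly_Mapping.keys y" for ps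
  proof -
    have len: "length ps = length ts" and nz: "prod_list (map2 coef (map (tree_decomp dg) ts) ps) \<noteq> (0::'k)"
      using that by (auto simp: y_def in_keys_iff lookup_tensor_list split: if_splits)
    have "coef (tree_decomp dg (ts ! i)) (ps ! i) \<noteq> (0::'k)" if "i < length ts" for i
    proof -
      have "coef (tree_decomp dg (ts ! i)) (ps ! i) \<in> set (map2 coef (map (tree_decomp dg :: _ \<Rightarrow> _ \<Rightarrow>\<^sub>0 'k) ts) ps)"
        using that len by (subst in_set_conv_nth) (auto intro!: exI[of _ i])
      with nz show ?thesis by (metis prod_list_zero_iff)
    qed
    then show ?thesis
      unfolding list_all_length
      using len Node.IH by (metis (mono_tags, lifting) case_prod_unfold nth_mem prod.collapse)
  qed
  show ?case
  proof (cases t)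
    case Leaf
    have "coef (lin f y) (Leaf, ss) = 0"
      by (intro lookup_lin_eq_0) (auto simp: f_def lookup_bas)
    then show ?thesis
      using Leaf by (cases ss) (auto simp: dec lookup_add lookup_bas simp del: tree_decomp.simps)
  next
    case t: (Node g' us)
    \<comment> \<open>The cuts of the children are determined by \<open>us\<close> and
      \<open>ss\<close>, because the leaves of the trees in \<open>us\<close> tell how
      \<open>ss\<close> breaks into blocks.\<close>
    have *: "ps = split_forest us ss \<and> length ss = sum_list (map leaves us)"
      if "ps \<in> Poly_Mapping.keys y" "coef (f ps) (t, ss) \<noteq> 0" for ps
      using that keys_y[OF that(1)] split_forest_unique[of ps] length_concat_forest[of ps]
      by (auto simp: f_def lookup_bas t split: if_splits)
    show ?thesis
    proof (cases "length ss = sum_list (map leaves us)")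
      case True
      have "coef (lin f y) (t, ss) = coef y (split_forest us ss) * coef (f (split_forest us ss)) (t, ss)"
        using * by (intro lookup_lin_unique) auto
      moreover have "coef y (split_forest us ss) * shuffle_sign dg (split_forest us ss) =
          (if full_graft_list us ss = ts then cut_sign_list dg us ss else 0)"
        unfolding y_def using Node.IH True by (intro lookup_tensor_split) auto
      ultimately show ?thesis
        using True
        by (auto simp: dec f_def lookup_add lookup_bas t concat_split_forest
            simp del: tree_decomp.simps)
    next
      case False
      then have "coef (lin f y) (t, ss) = 0"
        using * by (intro lookup_lin_eq_0) blast
      with False show ?thesis
        by (auto simp: dec lookup_add lookup_bas t simp del: tree_decomp.simps)
    qed
  qed
qed

lemma lookup_decomp:
  "coef (decomp dg x) (t, ss) =
     (if length ss = leaves t then cut_sign dg t ss * coef x (full_graft t ss) else 0 :: 'k::field)"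
  unfolding decomp_def
  by (subst lookup_lin_unique[where ?a0.0 = "full_graft t ss"])
    (auto simp: lookup_tree_decomp split: if_splits)


text \<open>Follows the mutual recursion of the grafting and sign functions over trees and lists,
  where the induction rule of the datatype would only offer a hypothesis for all members of a
  list.\<close>

lemma tree_forest_induct [case_names Leaf Node Nil Cons]:
  assumes "P Leaf" "\<And>g ts. Q ts \<Longrightarrow> P (Node g ts)"
    and "Q []" "\<And>t ts. P t \<Longrightarrow> Q ts \<Longrightarrow> Q (t # ts)"
  shows "P t" "Q ts"
proof -
  have *: "Q ts" if "\<forall>t\<in>set ts. P t" for ts
    using that by (induction ts) (auto intro: assms)
  show P: "P t" for t
    by (induction t) (auto intro: assms *)
  show "Q ts"
    by (rule *) (simp add: P)
qed

lemma full_graft_replicate_Leaf: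
  "n = leaves t \<Longrightarrow> full_graft t (replicate n Leaf) = t \<and> cut_sign dg t (replicate n Leaf) = (1::'k::field)"
  "n = sum_list (map leaves ts) \<Longrightarrow>
     full_graft_list ts (replicate n Leaf) = ts \<and> cut_sign_list dg ts (replicate n Leaf) = (1::'k)"
  by (induction t and ts arbitrary: n and n rule: tree_forest_induct)
    (auto simp: sum_list_replicate)

lemma leaves_full_graft:
  "length ss = leaves t \<Longrightarrow> leaves (full_graft t ss) = sum_list (map leaves ss)"
  "length ss = sum_list (map leaves ts) \<Longrightarrow>
     sum_list (map leaves (full_graft_list ts ss)) = sum_list (map leaves ss)"
proof (induction t ss and ts ss rule: full_graft_full_graft_list.induct)
  case (1 ss)
  then show ?case by (cases ss) auto
next
  case (4 t ts ss)
  have "sum_list (map leaves ss) =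
      sum_list (map leaves (take (leaves t) ss)) + sum_list (map leaves (drop (leaves t) ss))"
    by (metis append_take_drop_id map_append sum_list_append)
  with 4 show ?case by simp
qed auto

text \<open>The slot after \<open>pre\<close> is filled by \<open>s\<close> instead of a leaf; once
  \<open>pre\<close> is grafted, this slot is leaf number \<open>P pre\<close>. The trees of
  \<open>pre\<close> come before it in preorder and add no degree after it, so the only new sign is
  that of moving \<open>s\<close> past the later vertices of \<open>t\<close>.\<close>

lemma graft_snoc:
  fixes dg :: "'g \<Rightarrow> int" and s :: "'g tree"
  defines "ss \<equiv> \<lambda>pre r. pre @ s # replicate r Leaf"
    and "ss' \<equiv> \<lambda>pre r. pre @ Leaf # replicate r Leaf"
    and "P \<equiv> \<lambda>pre. Suc (sum_list (map leaves pre))"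
  shows
  "length pre + Suc r = leaves t \<Longrightarrow>
     full_graft t (ss pre r) = graft (full_graft t (ss' pre r)) (P pre) s \<and>
     deg_after dg (full_graft t (ss' pre r)) (P pre) = deg_after dg t (Suc (length pre)) \<and>
     cut_sign dg t (ss pre r) = cut_sign dg t (ss' pre r) *
       (sgn_pow (deg_after dg t (Suc (length pre)) * tdeg dg s) :: 'k::field)"
  "length pre + Suc r = sum_list (map leaves ts) \<Longrightarrow>
     full_graft_list ts (ss pre r) = graft_list (full_graft_list ts (ss' pre r)) (P pre) s \<and>
     deg_after_list dg (full_graft_list ts (ss' pre r)) (P pre) = deg_after_list dg ts (Suc (length pre)) \<and>
     cut_sign_list dg ts (ss pre r) = cut_sign_list dg ts (ss' pre r) *
       (sgn_pow (deg_after_list dg ts (Suc (length pre)) * tdeg dg s) :: 'k)"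
proof (induction t and ts arbitrary: pre r and pre r rule: tree_forest_induct)
  case Leaf
  then show ?case by (simp add: ss_def ss'_def P_def)
next
  case (Cons t ts)
  show ?case
  proof (cases "length pre < leaves t")
    case True
    \<comment> \<open>The slot lies in the first tree, and \<open>r1\<close> counts the leaves of
      that tree to the right of it. The remaining trailing entries \<open>Leaf\<close> belong to
      \<open>ts\<close>.\<close>
    define r1 where "r1 = leaves t - Suc (length pre)"
    have r: "r = r1 + sum_list (map leaves ts)" and r1: "length pre + Suc r1 = leaves t"
      using True Cons.prems by (auto simp: r1_def)
    have split: "take (leaves t) (pre @ u # replicate r Leaf) = pre @ u # replicate r1 Leaf"
      "drop (leaves t) (pre @ u # replicate r Leaf) = replicate (sum_list (map leaves ts)) Leaf"
      for u :: "'g tree"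
      by (simp_all add: r flip: r1)
    have "P pre \<le> leaves (full_graft t (ss' pre r1))"
      using r1 by (subst leaves_full_graft) (auto simp: ss'_def P_def)
    moreover have "sum_list (map (tdeg dg) (ss pre r1)) =
        sum_list (map (tdeg dg) (ss' pre r1)) + tdeg dg s"
      by (simp add: ss_def ss'_def)
    ultimately show ?thesis
      using Cons.IH(1)[OF r1] True
        full_graft_replicate_Leaf(2)[OF refl, of ts, where dg = dg and 'k = 'k]
      by (simp add: ss_def ss'_def split sgn_pow_add algebra_simps del: take_append drop_append)
  next
    case False
    define pre1 pre2 where "pre1 = take (leaves t) pre" and "pre2 = drop (leaves t) pre"
    have pre: "pre = pre1 @ pre2" and len: "length pre1 = leaves t"
      using False by (auto simp: pre1_def pre2_def)
    have "leaves (full_graft t pre1) = sum_list (map leaves pre1)"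
      by (rule leaves_full_graft(1)[OF len])
    moreover have "length pre2 + Suc r = sum_list (map leaves ts)"
      using Cons.prems len by (simp add: pre)
    note Cons.IH(2)[OF this]
    ultimately show ?thesis
      using len by (simp add: ss_def ss'_def P_def pre)
  qed
qed auto

lemma full_graft_single:
  fixes t s :: "'a tree"
  assumes "1 \<le> i" "i \<le> leaves t"
  defines "ss \<equiv> replicate (i - 1) Leaf @ s # replicate (leaves t - i) Leaf"
  shows "full_graft t ss = graft t i s"
    and "cut_sign dg t ss = (sgn_pow (deg_after dg t i * tdeg dg s) :: 'k::field)"
proof -
  obtain j r where i: "i = Suc j" and r: "leaves t = j + Suc r" "leaves t - i = r"
    using assms(1,2) that[of "i - 1" "leaves t - i"] by auto
  have eq: "replicate j Leaf @ Leaf # replicate r Leaf = (replicate (leaves t) Leaf :: 'a tree list)"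
    by (simp add: r replicate_add replicate_append_same)
  show "full_graft t ss = graft t i s"
    and "cut_sign dg t ss = (sgn_pow (deg_after dg t i * tdeg dg s) :: 'k::field)"
    using graft_snoc(1)[of "replicate j Leaf" r t s dg, where 'k = 'k]
      full_graft_replicate_Leaf(1)[OF refl, of t dg, where 'k = 'k] r
    by (simp_all add: ss_def i eq sum_list_replicate)
qed

lemma leaves_graft: "1 \<le> i \<Longrightarrow> i \<le> leaves t \<Longrightarrow> leaves (graft t i s) + 1 = leaves t + leaves s"
  by (subst full_graft_single(1)[symmetric]) (auto simp: leaves_full_graft sum_list_replicate)

section \<open>Infinitesimal decomposition of the tree cooperad\<close>

lemma lookup_single_out_0: "coef (single_out (t', ss)) (t, 0, s) = 0"
  by (simp add: single_out_def lookup_sum lookup_bas)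

lemma lookup_single_out_Suc:
  "coef (single_out (t', ss)) (t, Suc i, s) =
     (if t' = t \<and> i < length ss \<and> ss ! i = s \<and> (\<forall>l\<in>{..<length ss} - {i}. ss ! l = Leaf)
      then 1 else 0 :: 'k::field)"
proof -
  have if_nest: "(if I then (if A then 1 else 0) * (if B \<and> C then 1 else 0) else 0) =
      (if B \<and> I \<and> C \<and> A then 1 else 0 :: 'k)" for A B C I
    by simp
  define c :: "nat \<Rightarrow> 'k" where
    "c j = (\<Prod>l\<in>{..<length ss} - {j}. counit (bas (ss ! l) :: _ \<Rightarrow>\<^sub>0 'k))" for j
  have c: "c j = (if \<forall>l\<in>{..<length ss} - {j}. ss ! l = Leaf then 1 else 0)" for j
    unfolding c_def counit_def lookup_bas by (simp add: prod_zero_iff)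
  have "coef (single_out (t', ss)) (t, Suc i, s) =
      (\<Sum>j<length ss. c j * coef (bas (t', Suc j, ss ! j)) (t, Suc i, s))"
    by (simp add: single_out_def lookup_sum c_def)
  also have "\<dots> = (\<Sum>j<length ss. if j = i then c i * (if t' = t \<and> ss ! i = s then 1 else 0) else 0)"
    by (intro sum.cong refl) (simp add: lookup_bas)
  also have "\<dots> = (if i < length ss then c i * (if t' = t \<and> ss ! i = s then 1 else 0) else 0)"
    by (subst sum.delta) simp_all
  also have "\<dots> = (if t' = t \<and> i < length ss \<and> ss ! i = s \<and>
      (\<forall>l\<in>{..<length ss} - {i}. ss ! l = Leaf) then 1 else 0)"
    unfolding c by (rule if_nest)
  finally show ?thesis .
qed

lemma single_slot_list_iff:
  "i < length ss \<and> ss ! i = s \<and> (\<forall>l\<in>{..<length ss} - {i}. ss ! l = x) \<longleftrightarrow>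
     (\<exists>r. length ss = i + Suc r \<and> ss = replicate i x @ s # replicate r x)"
proof (intro iffI)
  assume *: "i < length ss \<and> ss ! i = s \<and> (\<forall>l\<in>{..<length ss} - {i}. ss ! l = x)"
  then obtain r where "length ss = i + Suc r"
    by (metis add_Suc_right less_imp_Suc_add)
  moreover from this * have "ss = replicate i x @ s # replicate r x"
    by (intro nth_equalityI) (auto simp: nth_append nth_Cons split: nat.split)
  ultimately show "\<exists>r. length ss = i + Suc r \<and> ss = replicate i x @ s # replicate r x"
    by blast
next
  assume "\<exists>r. length ss = i + Suc r \<and> ss = replicate i x @ s # replicate r x"
  then obtain r where "ss = replicate i x @ s # replicate r x"
    by blast
  then show "i < length ss \<and> ss ! i = s \<and> (\<forall>l\<in>{..<length ss} - {i}. ss ! l = x)"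
    by (auto simp: nth_append nth_Cons split: nat.split)
qed

text \<open>The counit kills every forest with a tree other than \<open>Leaf\<close> outside the
  chosen slot, so a single forest contributes. The result says that the infinitesimal decomposition
  is the transpose of the partial compositions \<open>pcomp\<close>, with the same Koszul
  sign.\<close>

lemma lookup_inf_decomp:
  "coef (inf_decomp dg x) (t, i, s) =
     (if 1 \<le> i \<and> i \<le> leaves t
      then sgn_pow (deg_after dg t i * tdeg dg s) * coef x (graft t i s) else 0 :: 'k::field)"
proof (cases i)
  case 0
  then show ?thesis
    unfolding inf_decomp_def by (subst lookup_lin_eq_0) (auto simp: lookup_single_out_0)
next
  case i: (Suc j)
  define ss where "ss = replicate j Leaf @ s # replicate (leaves t - i) Leaf"
  have *: "p = (t, ss) \<and> i \<le> leaves t"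
    if "p \<in> Poly_Mapping.keys (decomp dg x)" "coef (single_out p) (t, i, s) \<noteq> (0 :: 'k)" for p
  proof -
    obtain t' us where p: "p = (t', us)" by force
    with that have len: "length us = leaves t'"
      by (auto simp: in_keys_iff lookup_decomp split: if_splits)
    from that(2) have "t' = t \<and> (\<exists>r. length us = j + Suc r \<and> us = replicate j Leaf @ s # replicate r Leaf)"
      unfolding p i lookup_single_out_Suc single_slot_list_iff[symmetric] by presburger
    with len show ?thesis
      by (auto simp: p ss_def i)
  qed
  show ?thesis
  proof (cases "i \<le> leaves t")
    case True
    then have len: "length ss = leaves t" by (simp add: ss_def i)
    have "\<exists>r. length ss = j + Suc r \<and> ss = replicate j Leaf @ s # replicate r Leaf"
      unfolding ss_def by (intro exI[of _ "leaves t - i"]) simp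
    then have "coef (single_out (t, ss)) (t, i, s) = (1 :: 'k)"
      unfolding i lookup_single_out_Suc single_slot_list_iff[symmetric] by presburger
    moreover have "coef (inf_decomp dg x) (t, i, s) =
        coef (decomp dg x) (t, ss) * coef (single_out (t, ss)) (t, i, s)"
      unfolding inf_decomp_def using * by (intro lookup_lin_unique) blast
    ultimately show ?thesis
      using True len full_graft_single(1)[of i t s]
        full_graft_single(2)[of i t, where 'k = 'k]
      by (simp add: lookup_decomp ss_def i)
  next
    case False
    then have "coef (inf_decomp dg x) (t, i, s) = 0"
      unfolding inf_decomp_def using * by (intro lookup_lin_eq_0) blast
    with False show ?thesis by simp
  qed
qed

section \<open>The dual basis\<close>

text \<open>The coefficient of a tree in \<open>\<mu>\<close>, \<open>h\<close>, \<open>\<delta>\<close>, selected by the label \<open>GM\<close>, \<open>GH\<close>,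
  \<open>GD\<close>. The signs come from cutting below the root vertex; the exponent \<open>leaves t + 1\<close> stands for
  \<open>leaves t - 1\<close> without truncated subtraction.\<close>

fun cf :: "agd_gen \<Rightarrow> agd_gen tree \<Rightarrow> 'k::field" where
  "cf c Leaf = (if c = GM then 1 else 0)"
| "cf c (Node GM [t, u]) =
     (case c of
       GM \<Rightarrow> (-1) ^ (leaves t + 1) * cf GM t * cf GM u
     | GH \<Rightarrow> (-1) ^ (leaves t + leaves u) * cf GH t * cf GM u + (-1) ^ (leaves t + 1) * cf GM t * cf GH u
     | GD \<Rightarrow> (-1) ^ (leaves t + leaves u) * cf GD t * cf GM u + (-1) ^ (leaves t + 1) * cf GM t * cf GH u)"
| "cf c (Node GH [t]) = (if c = GH then (-1) ^ (leaves t + 1) * cf GM t else 0)"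
| "cf c (Node GD [t]) = (if c = GD then (-1) ^ (leaves t + 1) * cf GM t else 0)"
| "cf c (Node _ _) = 0"

lemma UNIV_agd_gen: "UNIV = {GM, GH, GD}"
  by (auto intro: agd_gen.exhaust)

lemma sum_agd_gen: "(\<Sum>c\<in>UNIV. f c) = f GM + f GH + f GD" for f :: "_ \<Rightarrow> 'k::field"
  by (simp add: UNIV_agd_gen add.assoc)

abbreviation sdeg :: "agd_gen \<Rightarrow> int" where
  "sdeg \<equiv> susp_degree agd_degree"

lemma sdeg: "sdeg g = 1"
  by (simp add: susp_degree_def agd_degree_def)

text \<open>The case \<open>other\<close> gathers all roots with a wrong number of children, on
  which \<open>cf\<close> vanishes.\<close>

lemma agd_tree_induct [case_names Leaf H D M other]:
  assumes "P Leaf" "\<And>t. P t \<Longrightarrow> P (Node GH [t])" "\<And>t. P t \<Longrightarrow> P (Node GD [t])"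
    and "\<And>t u. P t \<Longrightarrow> P u \<Longrightarrow> P (Node GM [t, u])"
    and "\<And>g ts. length ts \<noteq> agd_arity g \<Longrightarrow> P (Node g ts)"
  shows "P t"
proof (induction t)
  case (Node g ts)
  show ?case
  proof (cases "length ts = agd_arity g")
    case True
    then show ?thesis
      using Node assms(2,3,4)
      by (cases g) (auto simp: length_Suc_conv numeral_2_eq_2)
  qed (rule assms(5))
qed (rule assms)

lemma cf_bad_arity: "length ts \<noteq> agd_arity g \<Longrightarrow> cf c (Node g ts) = 0"
  by (cases "(c, Node g ts)" rule: cf.cases) auto

lemma tdeg_sdeg: "tdeg sdeg t = int (weight t)"
proof (induction t)
  case (Node g ts)
  then have "sum_list (map (tdeg sdeg) ts) = int (sum_list (map weight ts))"
    by (induction ts) auto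
  then show ?case using sdeg[of g] by simp
qed simp

text \<open>A binary tree has one vertex fewer than leaves, and for \<open>GH\<close> and
  \<open>GD\<close> one unary vertex is added. The additive form avoids truncated
  subtraction.\<close>

lemma cf_support:
  "(cf c t :: 'k::field) \<noteq> 0 \<Longrightarrow>
     wf_tree agd_arity t \<and> 1 \<le> leaves t \<and> weight t + 1 = leaves t + (if c = GM then 0 else 1)"
proof (induction t arbitrary: c rule: agd_tree_induct)
  case (other g ts)
  then show ?case by (simp add: cf_bad_arity)
next
  case (M t u)
  \<comment> \<open>Exactly one of the two subtrees carries the unary vertex if there is one; for
    \<open>GD\<close> the subtree labels are \<open>GD\<close>, \<open>GM\<close> or
    \<open>GM\<close>, \<open>GH\<close>.\<close>
  have "\<exists>a b. (cf a t :: 'k) \<noteq> 0 \<and> (cf b u :: 'k) \<noteq> 0 \<and>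
      (c = GM \<and> a = GM \<and> b = GM \<or> c \<noteq> GM \<and> (a = GM \<and> b \<noteq> GM \<or> a \<noteq> GM \<and> b = GM))"
  proof (cases c)
    case GH
    then have "(cf GH t :: 'k) \<noteq> 0 \<and> (cf GM u :: 'k) \<noteq> 0 \<or> (cf GM t :: 'k) \<noteq> 0 \<and> (cf GH u :: 'k) \<noteq> 0"
      using M.prems by auto
    with GH show ?thesis by blast
  next
    case GD
    then have "(cf GD t :: 'k) \<noteq> 0 \<and> (cf GM u :: 'k) \<noteq> 0 \<or> (cf GM t :: 'k) \<noteq> 0 \<and> (cf GH u :: 'k) \<noteq> 0"
      using M.prems by auto
    with GD show ?thesis by blast
  next
    case GM
    then show ?thesis using M.prems by auto
  qed
  then obtain a b where ab: "(cf a t :: 'k) \<noteq> 0" "(cf b u :: 'k) \<noteq> 0"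
      "c = GM \<and> a = GM \<and> b = GM \<or> c \<noteq> GM \<and> (a = GM \<and> b \<noteq> GM \<or> a \<noteq> GM \<and> b = GM)"
    by blast
  show ?case
    using M.IH(1)[OF ab(1)] M.IH(2)[OF ab(2)] ab(3) by (auto split: if_splits)
qed (force split: if_splits)+

text \<open>The coefficient of \<open>a \<boxtimes>\<^bsub>p + 1\<^esub> b\<close> in the infinitesimal decomposition of \<open>c\<close>, where \<open>b\<close> has
  arity \<open>q\<close> and \<open>a\<close> has arity \<open>p + r + 1\<close>.\<close>

definition comp_coeff :: "agd_gen \<Rightarrow> agd_gen \<Rightarrow> agd_gen \<Rightarrow> nat \<Rightarrow> nat \<Rightarrow> nat \<Rightarrow> 'k::field" where
  "comp_coeff c a b p q r =
     (if b = GM \<and> a = c \<and> c \<noteq> GM then (-1) ^ ((r + 1) * (q - 1))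
      else if a = GM \<and> b = (if c = GD \<and> p \<noteq> 0 then GH else c) then (-1) ^ (r * (q - 1))
      else 0)"

text \<open>Translates Koszul signs, which depend on degrees, into signs in the arities. Stated as
  vanishing, so that a case split on parities disposes of the combinations that cannot
  contribute.\<close>

lemma cf_degree_parity:
  "even (tdeg sdeg t) = even (leaves t) \<Longrightarrow> cf GM t = (0 :: 'k::field)"
  "even (tdeg sdeg t) \<noteq> even (leaves t) \<Longrightarrow> c \<noteq> GM \<Longrightarrow> cf c t = (0 :: 'k)"
  using cf_support[of GM t, where 'k = 'k] cf_support[of c t, where 'k = 'k]
  by (auto simp: tdeg_sdeg) (metis even_Suc)+

text \<open>Every term of the recursion for \<open>cf\<close> keeps a coefficient of the subtree
  that contains \<open>s\<close>. This treats upper trees without leaves, for which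
  \<open>q - 1\<close> in the signs would be truncated.\<close>

lemma cf_graft_eq_0:
  assumes "\<And>c. cf c s = (0 :: 'k::field)" "1 \<le> i" "i \<le> leaves t"
  shows "cf c (graft t i s) = (0 :: 'k)"
  using assms(2,3)
proof (induction t arbitrary: i c rule: agd_tree_induct)
  case (other g ts)
  have "length (graft_list us i s) = length us" for us i
    by (induction us arbitrary: i) auto
  with other show ?case by (simp add: cf_bad_arity)
next
  case (M t u)
  then show ?case by (cases c) auto
qed (auto simp: assms(1))

text \<open>The sign computation behind all three decomposition formulas, by induction on the lower
  tree: the graft goes into one child of the root, the induction hypothesis splits it there, and the
  root is put back onto the lower part. The Koszul sign in front is the one of
  \<open>lookup_inf_decomp\<close>, against which it cancels later.\<close>

lemma cf_graft:
  assumes "1 \<le> i" "i \<le> leaves t"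
  shows "cf c (graft t i s) = sgn_pow (deg_after sdeg t i * tdeg sdeg s) *
    (\<Sum>a\<in>UNIV. \<Sum>b\<in>UNIV. comp_coeff c a b (i - 1) (leaves s) (leaves t - i) * cf a t * (cf b s :: 'k::field))"
proof (cases "leaves s")
  case 0
  then have "cf a s = (0 :: 'k)" for a
    using cf_support[of a s, where 'k = 'k] by force
  moreover from this have "cf c (graft t i s) = (0 :: 'k)"
    by (rule cf_graft_eq_0[OF _ assms])
  ultimately show ?thesis by simp
next
  case q: (Suc q)
  note par_s = cf_degree_parity[of s, where 'k = 'k, unfolded q even_Suc]
  show ?thesis
    using assms
  proof (induction t arbitrary: i c rule: agd_tree_induct)
    case Leaf
    then show ?case by (cases c) (auto simp: sum_agd_gen comp_coeff_def)
  next
    case (H t)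
    define r where "r = leaves t - i"
    then have n: "leaves t = i + r" "leaves t - i = r" using H.prems by auto
    have lg: "leaves (graft t i s) = i + r + q"
      using leaves_graft[of i t s] H.prems q n by auto
    show ?case using H.prems
      by (cases c; cases "even i"; cases "even r"; cases "even q")
        (simp_all add: H.IH sum_agd_gen comp_coeff_def minus_one_power_iff lg q n)
  next
    case (D t)
    define r where "r = leaves t - i"
    then have n: "leaves t = i + r" "leaves t - i = r" using D.prems by auto
    have lg: "leaves (graft t i s) = i + r + q"
      using leaves_graft[of i t s] D.prems q n by auto
    show ?case using D.prems
      by (cases c; cases "even i"; cases "even r"; cases "even q")
        (simp_all add: D.IH sum_agd_gen comp_coeff_def minus_one_power_iff lg q n)
  next
    case (M t u)
    note par_u = cf_degree_parity[of u, where 'k = 'k]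
    show ?case
    proof (cases "i \<le> leaves t")
      case True
      obtain p where i: "i = Suc p"
        using M.prems by (cases i) auto
      define r where "r = leaves t - i"
      then have n: "leaves t = Suc (p + r)" using True i by auto
      have lg: "leaves (graft t (Suc p) s) = Suc (p + r + q)"
        using leaves_graft[of i t s] M.prems q n i by auto
      note IH = M.IH(1)[OF M.prems(1) True, unfolded i n, simplified]
      \<comment> \<open>Exponents matter only modulo 2 and \<open>par_u\<close>,
        \<open>par_s\<close> tie degrees to arities, so the sign identity is a finite check over
        parities.\<close>
      show ?thesis
        using par_u par_s unfolding i
        by (cases c; cases "even p"; cases "even r"; cases "even q"; cases "even (leaves u)";
            cases "even (tdeg sdeg s)"; cases "even (tdeg sdeg u)"; cases "even (deg_after sdeg t (Suc p))")
          (simp_all add: IH sum_agd_gen comp_coeff_def minus_one_power_iff lg q n sgn_pow_def algebra_simps)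
    next
      case False
      obtain l where l: "i = leaves t + Suc l"
        using False less_imp_Suc_add[of "leaves t" i] by auto
      define r where "r = leaves u - Suc l"
      then have n: "leaves u = Suc (l + r)" using l M.prems by auto
      have lg: "leaves (graft u (Suc l) s) = Suc (l + r + q)"
        using leaves_graft[of "Suc l" u s] q n by auto
      have "1 \<le> Suc l" "Suc l \<le> leaves u" using n by auto
      note IH = M.IH(2)[OF this, unfolded n, simplified]
      \<comment> \<open>For \<open>GD\<close> the right subtree contributes through
        \<open>GH\<close>. This agrees with \<open>comp_coeff\<close> because a slot in the right
        subtree has \<open>p \<noteq> 0\<close> as soon as the left subtree has a leaf; a left
        subtree without leaves makes both sides 0.\<close>
      show ?thesis
      proof (cases "leaves t")
        case 0
        then have "cf a t = (0 :: 'k)" for a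
          using cf_support[of a t, where 'k = 'k] by force
        then show ?thesis
          by (cases c) (simp_all add: sum_agd_gen comp_coeff_def l)
      next
        case (Suc k)
        then show ?thesis
          using par_u par_s unfolding l
          by (cases c; cases "even l"; cases "even r"; cases "even q"; cases "even k";
              cases "even (tdeg sdeg s)"; cases "even (tdeg sdeg u)"; cases "even (deg_after sdeg u (Suc l))")
            (simp_all add: IH sum_agd_gen comp_coeff_def minus_one_power_iff lg q n sgn_pow_def algebra_simps)
      qed
    qed
  next
    case (other g ts)
    have "length (graft_list us i s) = length us" for us i
      by (induction us arbitrary: i) auto
    with other show ?case by (simp add: cf_bad_arity)
  qed
qed

section \<open>The infinitesimal decomposition\<close>

text \<open>Makes \<open>dual_elem\<close> finitely supported. Because of unary vertices there are
  infinitely many trees with a given positive number of leaves, so the bound is on the weight, which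
  \<open>cf_support\<close> controls by the arity.\<close>

lemma finite_trees: "finite {t. wf_tree agd_arity t \<and> weight t \<le> w}"
proof (induction w)
  case 0
  have "{t. wf_tree agd_arity t \<and> weight t \<le> 0} \<subseteq> {Leaf}"
  proof
    fix t :: "agd_gen tree" assume "t \<in> {t. wf_tree agd_arity t \<and> weight t \<le> 0}"
    then show "t \<in> {Leaf}" by (cases t) simp_all
  qed
  then show ?case by (rule finite_subset) simp
next
  case (Suc w)
  let ?A = "{t. wf_tree agd_arity t \<and> weight t \<le> w}"
  let ?L = "{ts. set ts \<subseteq> ?A \<and> length ts \<le> 2}"
  have "{t. wf_tree agd_arity t \<and> weight t \<le> Suc w} \<subseteq> insert Leaf ((\<lambda>(g, ts). Node g ts) ` (UNIV \<times> ?L))"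
  proof
    fix t :: "agd_gen tree" assume t: "t \<in> {t. wf_tree agd_arity t \<and> weight t \<le> Suc w}"
    show "t \<in> insert Leaf ((\<lambda>(g, ts). Node g ts) ` (UNIV \<times> ?L))"
    proof (cases t)
      case (Node g ts)
      have "weight u \<le> w" if "u \<in> set ts" for u
        using member_le_sum_list[of "weight u" "map weight ts"] that t by (simp add: Node)
      moreover have "length ts \<le> 2"
        using t by (cases g) (simp_all add: Node)
      ultimately have "ts \<in> ?L" using t by (auto simp: Node)
      then show ?thesis unfolding Node by blast
    qed simp
  qed
  moreover have "finite (UNIV \<times> ?L :: (agd_gen \<times> _) set)"
    by (intro finite_cartesian_product finite_lists_length_le Suc) (simp add: UNIV_agd_gen)
  ultimately show ?case
    by (meson finite_subset finite_insert finite_imageI)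
qed

definition dual_elem :: "agd_gen \<Rightarrow> nat \<Rightarrow> (agd_gen tree \<Rightarrow>\<^sub>0 'k::field)" where
  "dual_elem c n = Abs_poly_mapping (\<lambda>t. if leaves t = n then cf c t else 0)"

lemma lookup_dual_elem: "coef (dual_elem c n) t = (if leaves t = n then cf c t else 0 :: 'k::field)"
proof -
  have "{t. (if leaves t = n then cf c t else 0 :: 'k) \<noteq> 0} \<subseteq> {t. wf_tree agd_arity t \<and> weight t \<le> n}"
    using cf_support[of c _, where 'k = 'k] by (fastforce split: if_splits)
  then have "finite {t. (if leaves t = n then cf c t else 0 :: 'k) \<noteq> 0}"
    by (rule finite_subset) (rule finite_trees)
  then show ?thesis
    unfolding dual_elem_def by (simp add: Abs_poly_mapping_inverse)
qed

lemma keys_dual_elem: "t \<in> Poly_Mapping.keys (dual_elem c n :: _ \<Rightarrow>\<^sub>0 'k::field) \<Longrightarrow>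
    leaves t = n \<and> wf_tree agd_arity t \<and> 1 \<le> n \<and> weight t + 1 = n + (if c = GM then 0 else 1)"
  using cf_support[of c t, where 'k = 'k] by (auto simp: in_keys_iff lookup_dual_elem split: if_splits)

text \<open>The Koszul signs of \<open>lookup_inf_decomp\<close> and of \<open>cf_graft\<close>
  coincide, so their product is 1 and only \<open>comp_coeff\<close> is left.\<close>

lemma lookup_inf_decomp_dual_elem:
  assumes "leaves t = Suc (p + r)"
  shows "coef (inf_decomp sdeg (dual_elem c n)) (t, Suc p, s) =
     (if p + leaves s + r = n
      then \<Sum>a\<in>UNIV. \<Sum>b\<in>UNIV. comp_coeff c a b p (leaves s) r * cf a t * cf b s
      else 0 :: 'k::field)"
proof -
  have "sgn_pow d * (sgn_pow d * x) = (x :: 'k)" for d x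
    by (simp add: sgn_pow_def)
  moreover have "leaves (graft t (Suc p) s) = p + leaves s + r"
    using leaves_graft[of "Suc p" t s] assms by simp
  moreover have "cf c (graft t (Suc p) s) = sgn_pow (deg_after sdeg t (Suc p) * tdeg sdeg s) *
    (\<Sum>a\<in>UNIV. \<Sum>b\<in>UNIV. comp_coeff c a b p (leaves s) r * cf a t * (cf b s :: 'k))"
    using cf_graft[of "Suc p" t c s, where 'k = 'k] assms by simp
  ultimately show ?thesis
    using assms by (simp add: lookup_inf_decomp lookup_dual_elem)
qed

text \<open>Only one summand can contribute: \<open>p\<close> is read off from the slot,
  \<open>q\<close> from the leaves of \<open>s\<close>, and then \<open>r\<close> from the leaves of
  \<open>t\<close>.\<close>

lemma lookup_sum_boxtimes:
  assumes "finite S" "leaves t = Suc (p + r)"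
  shows "coef (\<Sum>(p, q, r)\<in>S. scl (k p q r) (dual_elem a (p + r + 1) \<boxtimes>\<^bsub>p + 1\<^esub> dual_elem b q)) (t, Suc p, s) =
    (if (p, leaves s, r) \<in> S then k p (leaves s) r * cf a t * cf b s else 0 :: 'k::field)"
proof -
  have "coef (\<Sum>(p, q, r)\<in>S. scl (k p q r) (dual_elem a (p + r + 1) \<boxtimes>\<^bsub>p + 1\<^esub> dual_elem b q)) (t, Suc p, s) =
    (\<Sum>x\<in>S. if x = (p, leaves s, r) then k p (leaves s) r * cf a t * cf b s else 0)"
    unfolding lookup_sum
    by (intro sum.cong refl) (auto simp: lookup_boxtimes lookup_dual_elem assms(2) split: if_splits)
  then show ?thesis
    using assms(1) by simp
qed

lemma lookup_sum_boxtimes_eq_0: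
  assumes "\<And>p r. j = Suc p \<Longrightarrow> leaves t \<noteq> Suc (p + r)"
  shows "coef (\<Sum>(p, q, r)\<in>S. scl (k p q r) (dual_elem a (p + r + 1) \<boxtimes>\<^bsub>p + 1\<^esub> dual_elem b q)) (t, j, s) =
    (0 :: 'k::field)"
  unfolding lookup_sum
proof (intro sum.neutral ballI, clarify)
  fix p q r
  show "coef (scl (k p q r) (dual_elem a (p + r + 1) \<boxtimes>\<^bsub>p + 1\<^esub> dual_elem b q)) (t, j, s) = (0 :: 'k)"
    using assms[of p r] by (cases "j = Suc p") (simp_all add: lookup_boxtimes lookup_dual_elem)
qed

text \<open>Brings the sum over \<open>q\<close> and \<open>r\<close> in the formula for \<delta>
  into the shape of the other sums, with \<open>p\<close> equal to 0.\<close>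

lemma sum_boxtimes_1:
  "(\<Sum>(q, r)\<in>S. scl (k q r) (dual_elem a (r + 1) \<boxtimes>\<^bsub>1\<^esub> dual_elem b q)) =
   (\<Sum>(p, q, r)\<in>{0} \<times> S. scl (k q r) (dual_elem a (p + r + 1) \<boxtimes>\<^bsub>p + 1\<^esub> dual_elem b q))"
  by (simp add: sum.cartesian_product[symmetric])

lemma finite_compositions:
  "finite {(p, q, r). p + q + r = (n::nat) \<and> P p q r}" "finite {(q, r). q + r = (n::nat) \<and> P' q r}"
proof -
  show "finite {(p, q, r). p + q + r = n \<and> P p q r}"
    by (rule finite_subset[of _ "{..n} \<times> {..n} \<times> {..n}"]) auto
  show "finite {(q, r). q + r = n \<and> P' q r}"
    by (rule finite_subset[of _ "{..n} \<times> {..n}"]) auto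
qed

text \<open>Splits the basis elements into those with a slot inside \<open>t\<close> and an upper
  tree with a leaf, those with an upper tree invisible to \<open>cf\<close>, and those with a slot
  outside \<open>t\<close>. The second kind covers \<open>leaves s = 0\<close>, where the sums over
  \<open>q\<close> \<ge> 1 have no term.\<close>

lemma inf_decomp_dual_elem_eqI:
  fixes n :: nat
  assumes "\<And>t p r s. leaves t = Suc (p + r) \<Longrightarrow> 1 \<le> leaves s \<Longrightarrow> coef y (t, Suc p, s) =
      (if p + leaves s + r = n
       then \<Sum>a\<in>UNIV. \<Sum>b\<in>UNIV. comp_coeff c a b p (leaves s) r * cf a t * cf b s
       else 0 :: 'k::field)"
    and "\<And>t p r s. leaves t = Suc (p + r) \<Longrightarrow> (\<And>b. cf b s = (0 :: 'k)) \<Longrightarrow> coef y (t, Suc p, s) = 0"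
    and "\<And>t j s. (\<And>p r. j = Suc p \<Longrightarrow> leaves t \<noteq> Suc (p + r)) \<Longrightarrow> coef y (t, j, s) = 0"
  shows "inf_decomp sdeg (dual_elem c n) = y"
proof (rule poly_mapping_eqI, clarify)
  fix t j s
  show "coef (inf_decomp sdeg (dual_elem c n)) (t, j, s) = coef y (t, j, s)"
  proof (cases "\<exists>p r. j = Suc p \<and> leaves t = Suc (p + r)")
    case True
    then obtain p r where j: "j = Suc p" and n: "leaves t = Suc (p + r)" by blast
    show ?thesis
    proof (cases "leaves s = 0")
      case True
      then have "cf b s = (0 :: 'k)" for b
        using cf_support[of b s, where 'k = 'k] by force
      then show ?thesis
        using assms(2)[OF n, of s] by (simp add: j lookup_inf_decomp_dual_elem[OF n])
    next
      case False
      then show ?thesis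
        using assms(1)[OF n, of s] by (simp add: j lookup_inf_decomp_dual_elem[OF n])
    qed
  next
    case False
    then have "\<not> (1 \<le> j \<and> j \<le> leaves t)"
      by (metis Suc_le_D One_nat_def add_Suc le_Suc_ex)
    then have "coef (inf_decomp sdeg (dual_elem c n)) (t, j, s) = (0 :: 'k)"
      unfolding lookup_inf_decomp by (rule if_not_P)
    then show ?thesis
      using False assms(3)[of j t s] by simp
  qed
qed

lemmas lookup_boxtimes_simps = lookup_add sum_boxtimes_1
  lookup_sum_boxtimes[OF finite_compositions(1)]
  lookup_sum_boxtimes[OF finite_cartesian_product[OF finite.insertI[OF finite.emptyI] finite_compositions(2)]]
  lookup_sum_boxtimes_eq_0

text \<open>Each formula is the table \<open>comp_coeff\<close> written as sums. For
  \<open>GD\<close> the upper label depends on whether \<open>p\<close> is 0, which gives the two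
  sums with \<open>GM\<close> below.\<close>

lemma
  fixes n :: nat
  defines "S \<equiv> {(p, q, r). p + q + r = n \<and> 1 \<le> q}"
  shows inf_decomp_mu: "inf_decomp sdeg (dual_elem GM n :: _ \<Rightarrow>\<^sub>0 'k::field) =
      (\<Sum>(p, q, r) \<in> S. scl ((-1) ^ (r * (q - 1))) (dual_elem GM (p + r + 1) \<boxtimes>\<^bsub>p + 1\<^esub> dual_elem GM q))"
    and inf_decomp_h: "inf_decomp sdeg (dual_elem GH n :: _ \<Rightarrow>\<^sub>0 'k) =
      (\<Sum>(p, q, r) \<in> S. scl ((-1) ^ (r * (q - 1))) (dual_elem GM (p + r + 1) \<boxtimes>\<^bsub>p + 1\<^esub> dual_elem GH q)) +
      (\<Sum>(p, q, r) \<in> S. scl ((-1) ^ ((r + 1) * (q - 1))) (dual_elem GH (p + r + 1) \<boxtimes>\<^bsub>p + 1\<^esub> dual_elem GM q))"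
    and inf_decomp_delta: "inf_decomp sdeg (dual_elem GD n :: _ \<Rightarrow>\<^sub>0 'k) =
      (\<Sum>(p, q, r) \<in> S. scl ((-1) ^ ((r + 1) * (q - 1))) (dual_elem GD (p + r + 1) \<boxtimes>\<^bsub>p + 1\<^esub> dual_elem GM q)) +
      (\<Sum>(q, r) \<in> {(q, r). q + r = n \<and> 1 \<le> q}.
         scl ((-1) ^ (r * (q - 1))) (dual_elem GM (r + 1) \<boxtimes>\<^bsub>1\<^esub> dual_elem GD q)) +
      (\<Sum>(p, q, r) \<in> {(p, q, r). p + q + r = n \<and> 1 \<le> q \<and> 1 \<le> p}.
         scl ((-1) ^ (r * (q - 1))) (dual_elem GM (p + r + 1) \<boxtimes>\<^bsub>p + 1\<^esub> dual_elem GH q))"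
  unfolding sum_boxtimes_1
  by (rule inf_decomp_dual_elem_eqI;
      auto simp: lookup_boxtimes_simps sum_agd_gen comp_coeff_def S_def simp del: One_nat_def)+

section \<open>The spanned sub-cooperad\<close>

lemma sum_lists_Suc:
  fixes f :: "'a list \<Rightarrow> 'k::comm_monoid_add"
  shows "(\<Sum>l\<in>{l. length l = Suc n}. f l) = (\<Sum>l\<in>{l. length l = n}. \<Sum>b\<in>UNIV. f (l @ [b]))"
proof -
  have "(\<Sum>l\<in>{l. length l = n}. \<Sum>b\<in>UNIV. f (l @ [b])) = (\<Sum>(l, b)\<in>{l. length l = n} \<times> UNIV. f (l @ [b]))"
    by (rule sum.cartesian_product)
  also have "\<dots> = (\<Sum>l\<in>{l. length l = Suc n}. f l)"
  proof (rule sum.reindex_bij_witness[where i = "\<lambda>l. (butlast l, last l)" and j = "\<lambda>(l, b). l @ [b]"])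
    fix l :: "'a list" assume "l \<in> {l. length l = Suc n}"
    then show "(\<lambda>(l, b). l @ [b]) (butlast l, last l) = l"
      by (cases l rule: rev_cases) auto
  qed auto
  finally show ?thesis by simp
qed

lemma sum_rotate:
  "(\<Sum>a'\<in>A'. \<Sum>b\<in>B. \<Sum>a\<in>A. \<Sum>d\<in>D. F a' b a d) = (\<Sum>a\<in>A. \<Sum>d\<in>D. \<Sum>b\<in>B. \<Sum>a'\<in>A'. F a' b a d)"
proof -
  have "(\<Sum>a'\<in>A'. \<Sum>b\<in>B. \<Sum>a\<in>A. \<Sum>d\<in>D. F a' b a d) = (\<Sum>a'\<in>A'. \<Sum>a\<in>A. \<Sum>b\<in>B. \<Sum>d\<in>D. F a' b a d)"
    by (intro sum.cong refl sum.swap)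
  also have "\<dots> = (\<Sum>a\<in>A. \<Sum>a'\<in>A'. \<Sum>b\<in>B. \<Sum>d\<in>D. F a' b a d)"
    by (rule sum.swap)
  also have "\<dots> = (\<Sum>a\<in>A. \<Sum>a'\<in>A'. \<Sum>d\<in>D. \<Sum>b\<in>B. F a' b a d)"
    by (intro sum.cong refl sum.swap)
  also have "\<dots> = (\<Sum>a\<in>A. \<Sum>d\<in>D. \<Sum>a'\<in>A'. \<Sum>b\<in>B. F a' b a d)"
    by (intro sum.cong refl sum.swap)
  also have "\<dots> = (\<Sum>a\<in>A. \<Sum>d\<in>D. \<Sum>b\<in>B. \<Sum>a'\<in>A'. F a' b a d)"
    by (intro sum.cong refl sum.swap)
  finally show ?thesis .
qed

text \<open>One step of the iteration over a forest. Here \<open>T\<close> is \<open>t\<close> with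
  \<open>pre\<close> already grafted, so adding \<open>s\<close> is a single graft, to which
  \<open>cf_graft\<close> applies; the sign gained by the cut cancels the Koszul sign of that
  graft.\<close>

lemma full_graft_snoc:
  assumes "leaves t = length pre + Suc r"
  defines "T \<equiv> full_graft t (pre @ replicate (Suc r) Leaf)"
  shows "leaves T = Suc (sum_list (map leaves pre) + r)"
    and "cut_sign sdeg t ((pre @ [s]) @ replicate r Leaf) * cf c (full_graft t ((pre @ [s]) @ replicate r Leaf)) =
      (\<Sum>a\<in>UNIV. \<Sum>b\<in>UNIV. comp_coeff c a b (sum_list (map leaves pre)) (leaves s) r *
        (cut_sign sdeg t (pre @ replicate (Suc r) Leaf) * cf a T) * (cf b s :: 'k::field))"
proof -
  let ?P = "sum_list (map leaves pre)"
  have len: "length pre + Suc r = leaves t" using assms(1) by simp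
  show T: "leaves T = Suc (?P + r)"
    unfolding T_def using assms(1) by (subst leaves_full_graft) (auto simp: sum_list_replicate)
  let ?X = "cut_sign sdeg t (pre @ replicate (Suc r) Leaf) :: 'k"
  let ?g = "sgn_pow (deg_after sdeg t (Suc (length pre)) * tdeg sdeg s) :: 'k"
  let ?Y = "\<Sum>a\<in>UNIV. \<Sum>b\<in>UNIV. comp_coeff c a b ?P (leaves s) r * cf a T * (cf b s :: 'k)"
  have *: "full_graft t ((pre @ [s]) @ replicate r Leaf) = graft T (Suc ?P) s"
    "deg_after sdeg T (Suc ?P) = deg_after sdeg t (Suc (length pre))"
    "cut_sign sdeg t ((pre @ [s]) @ replicate r Leaf) = ?X * ?g"
    using graft_snoc(1)[OF len, of s sdeg, where 'k = 'k] by (simp_all add: T_def)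
  have "cf c (graft T (Suc ?P) s) = ?g * ?Y"
    using cf_graft[of "Suc ?P" T c s, where 'k = 'k] T *(2) by simp
  then have "cut_sign sdeg t ((pre @ [s]) @ replicate r Leaf) * cf c (full_graft t ((pre @ [s]) @ replicate r Leaf)) =
      ?X * (?g * ?g) * ?Y"
    unfolding * by (simp only: mult.assoc)
  also have "?g * ?g = 1"
    by (simp add: sgn_pow_def)
  finally show "cut_sign sdeg t ((pre @ [s]) @ replicate r Leaf) * cf c (full_graft t ((pre @ [s]) @ replicate r Leaf)) =
      (\<Sum>a\<in>UNIV. \<Sum>b\<in>UNIV. comp_coeff c a b ?P (leaves s) r * (?X * cf a T) * (cf b s :: 'k))"
    by (simp add: sum_distrib_left mult_ac)
qed

text \<open>Grafting a whole forest is grafting its trees one at a time from left to right. Only the existence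
  of coefficients depending on the arities is needed.\<close>

lemma cf_full_graft:
  "\<exists>K. \<forall>t pre. leaves t = length ms + r \<longrightarrow> map leaves pre = ms \<longrightarrow>
     cut_sign sdeg t (pre @ replicate r Leaf) * cf c (full_graft t (pre @ replicate r Leaf)) =
     (\<Sum>a\<in>UNIV. \<Sum>bs\<in>{bs. length bs = length ms}. K a bs * cf a t * (prod_list (map2 cf bs pre) :: 'k::field))"
proof (induction ms arbitrary: c r rule: rev_induct)
  case Nil
  show ?case
  proof (intro exI[of _ "\<lambda>a bs. if a = c then 1 else 0"] allI impI)
    fix t :: "agd_gen tree" and pre :: "agd_gen tree list"
    assume t: "leaves t = length ([] :: nat list) + r" and "map leaves pre = []"
    then have pre: "pre = []" by simp
    have r: "r = leaves t" using t by simp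
    have "{bs :: agd_gen list. length bs = length ([] :: nat list)} = {[]}" by auto
    then show "cut_sign sdeg t (pre @ replicate r Leaf) * cf c (full_graft t (pre @ replicate r Leaf)) =
     (\<Sum>a\<in>UNIV. \<Sum>bs\<in>{bs. length bs = length ([] :: nat list)}. (if a = c then 1 else 0) * cf a t * (prod_list (map2 cf bs pre) :: 'k))"
      using full_graft_replicate_Leaf(1)[OF r, of sdeg, where 'k = 'k]
      by (cases c) (simp_all add: sum_agd_gen pre)
  qed
next
  case (snoc m ms)
  \<comment> \<open>The hypothesis is taken with one more free leaf, the slot of the last tree, and
    for all labels \<open>a'\<close> of the partially grafted tree at once.\<close>
  obtain K where "\<forall>a' t pre. leaves t = length ms + Suc r \<longrightarrow> map leaves pre = ms \<longrightarrow>
     cut_sign sdeg t (pre @ replicate (Suc r) Leaf) * cf a' (full_graft t (pre @ replicate (Suc r) Leaf)) =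
     (\<Sum>a\<in>UNIV. \<Sum>bs\<in>{bs. length bs = length ms}. K a' a bs * cf a t * (prod_list (map2 cf bs pre) :: 'k))"
    using choice[OF allI, OF snoc.IH[where r = "Suc r"]] by (rule exE)
  then have K: "cut_sign sdeg t (pre @ replicate (Suc r) Leaf) * cf a' (full_graft t (pre @ replicate (Suc r) Leaf)) =
     (\<Sum>a\<in>UNIV. \<Sum>bs\<in>{bs. length bs = length ms}. K a' a bs * cf a t * (prod_list (map2 cf bs pre) :: 'k))"
    if "leaves t = length ms + Suc r" "map leaves pre = ms" for a' t pre
    using that by blast
  \<comment> \<open>The last tree is split off first, leaving a tree of label \<open>a'\<close>,
    which is then split along \<open>ms\<close>; the label \<open>a'\<close> is summed out. The last
    entry of \<open>l\<close> labels the last tree, which has \<open>m\<close> leaves and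
    \<open>sum_list ms\<close> leaves to its left.\<close>
  define K' where "K' a l = (\<Sum>a'\<in>UNIV. comp_coeff c a' (last l) (sum_list ms) m r * K a' a (butlast l))" for a l
  show ?case
  proof (intro exI[of _ K'] allI impI)
    fix t :: "agd_gen tree" and pre :: "agd_gen tree list"
    assume t: "leaves t = length (ms @ [m]) + r" and pre_ms: "map leaves pre = ms @ [m]"
    from pre_ms obtain pre' s where pre: "pre = pre' @ [s]" "map leaves pre' = ms" "leaves s = m"
      unfolding map_eq_append_conv by fastforce
    then have len: "length pre' = length ms" by (metis length_map)
    let ?B = "{bs :: agd_gen list. length bs = length ms}"
    have "cut_sign sdeg t (pre @ replicate r Leaf) * cf c (full_graft t (pre @ replicate r Leaf)) =
      (\<Sum>a'\<in>UNIV. \<Sum>b\<in>UNIV. comp_coeff c a' b (sum_list ms) m r *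
        (\<Sum>a\<in>UNIV. \<Sum>bs\<in>?B. K a' a bs * cf a t * prod_list (map2 cf bs pre')) * (cf b s :: 'k))"
    proof -
      have t': "leaves t = length pre' + Suc r" "leaves t = length ms + Suc r"
        using t len by simp_all
      show ?thesis
        unfolding pre(1) full_graft_snoc(2)[OF t'(1)] pre(2,3) K[OF t'(2) pre(2)] ..
    qed
    also have "\<dots> = (\<Sum>a'\<in>UNIV. \<Sum>b\<in>UNIV. \<Sum>a\<in>UNIV. \<Sum>bs\<in>?B.
        comp_coeff c a' b (sum_list ms) m r * K a' a bs * cf a t * (prod_list (map2 cf bs pre') * cf b s))"
      by (simp add: sum_distrib_left sum_distrib_right mult_ac)
    also have "\<dots> = (\<Sum>a\<in>UNIV. \<Sum>bs\<in>?B. \<Sum>b\<in>UNIV. \<Sum>a'\<in>UNIV.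
        comp_coeff c a' b (sum_list ms) m r * K a' a bs * cf a t * (prod_list (map2 cf bs pre') * cf b s))"
      by (rule sum_rotate)
    also have "\<dots> = (\<Sum>a\<in>UNIV. \<Sum>l\<in>{l. length l = Suc (length ms)}. K' a l * cf a t * prod_list (map2 cf l pre))"
      unfolding sum_lists_Suc K'_def
      by (intro sum.cong refl) (simp add: pre(1) len sum_distrib_left sum_distrib_right mult_ac)
    finally show "cut_sign sdeg t (pre @ replicate r Leaf) * cf c (full_graft t (pre @ replicate r Leaf)) =
      (\<Sum>a\<in>UNIV. \<Sum>bs\<in>{bs. length bs = length (ms @ [m])}. K' a bs * cf a t * prod_list (map2 cf bs pre))"
      by simp
  qed
qed

definition dual_span :: "nat \<Rightarrow> (agd_gen tree \<Rightarrow>\<^sub>0 'k::field) set" where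
  "dual_span n = scl.span {dual_elem GM n, dual_elem GH n, dual_elem GD n}"

lemma dual_elem_in_span: "(dual_elem c n :: _ \<Rightarrow>\<^sub>0 'k::field) \<in> dual_span n"
  unfolding dual_span_def by (cases c) (auto intro: scl.span_base)

lemma dual_span_induct:
  assumes "scl.subspace S" "\<And>c. dual_elem c n \<in> S"
  shows "dual_span n \<subseteq> S"
  unfolding dual_span_def using assms by (intro scl.span_minimal) auto

lemma prod_list_dual_elem:
  "length bs = length ms \<Longrightarrow> length ms = length ss \<Longrightarrow>
     prod_list (map2 coef (map2 dual_elem bs ms) ss) =
     (if map leaves ss = ms then prod_list (map2 cf bs ss) else 0 :: 'k::field)"
  by (induction bs ms ss rule: list_induct3) (auto simp: lookup_dual_elem)

text \<open>By \<open>cf_full_graft\<close> the decomposition is a combination of elementary tensors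
  of dual elements, with coefficients that depend only on the labels and on the arities of the upper
  trees.\<close>

lemma decomp_dual_elem: "decomp sdeg (dual_elem c n :: _ \<Rightarrow>\<^sub>0 'k::field) \<in> comp_prod dual_span n"
proof -
  define y where "y = (decomp sdeg (dual_elem c n) :: _ \<Rightarrow>\<^sub>0 'k::field)"
  \<comment> \<open>The lists of arities of the upper forests that occur. They are finitely many
    because \<open>y\<close> has finite support.\<close>
  define S where "S = (\<lambda>(t, ss). map leaves ss) ` Poly_Mapping.keys y"
  obtain K where "\<forall>ms t ss. leaves t = length ms + 0 \<longrightarrow> map leaves ss = ms \<longrightarrow>
     cut_sign sdeg t (ss @ replicate 0 Leaf) * cf c (full_graft t (ss @ replicate 0 Leaf)) =
     (\<Sum>a\<in>UNIV. \<Sum>bs\<in>{bs. length bs = length ms}. K ms a bs * cf a t * (prod_list (map2 cf bs ss) :: 'k))"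
    using choice[OF allI, OF cf_full_graft[where r = 0 and c = c and 'k = 'k]] by (rule exE)
  then have K: "cut_sign sdeg t ss * cf c (full_graft t ss) =
     (\<Sum>a\<in>UNIV. \<Sum>bs\<in>{bs. length bs = length ms}. K ms a bs * cf a t * (prod_list (map2 cf bs ss) :: 'k))"
    if "leaves t = length ms" "map leaves ss = ms" for ms t ss
    using that by simp
  have S: "sum_list ms = n" if "ms \<in> S" for ms
  proof -
    from that obtain t ss where "(t, ss) \<in> Poly_Mapping.keys y" and ms: "ms = map leaves ss"
      unfolding S_def by auto
    then have "length ss = leaves t" "leaves (full_graft t ss) = n"
      by (auto simp: y_def in_keys_iff lookup_decomp lookup_dual_elem split: if_splits)
    then show ?thesis by (simp add: ms leaves_full_graft)
  qed
  have "y = (\<Sum>ms\<in>S. \<Sum>a\<in>UNIV. \<Sum>bs\<in>{bs. length bs = length ms}.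
      scl (K ms a bs) (elem_tensor (dual_elem a (length ms)) (map2 dual_elem bs ms)))" (is "_ = ?z")
  proof (rule poly_mapping_eqI, clarify)
    fix t :: "agd_gen tree" and ss :: "agd_gen tree list"
    have "coef ?z (t, ss) = (\<Sum>ms\<in>S. if ms = map leaves ss then
        if leaves t = length ss then (\<Sum>a\<in>UNIV. \<Sum>bs\<in>{bs. length bs = length ms}.
           K ms a bs * cf a t * prod_list (map2 cf bs ss)) else 0 else 0)"
      unfolding lookup_sum
    proof (intro sum.cong refl)
      fix ms
      let ?P = "ms = map leaves ss \<and> leaves t = length ss"
      have "coef (scl (K ms a bs) (elem_tensor (dual_elem a (length ms)) (map2 dual_elem bs ms))) (t, ss) =
          (if ?P then K ms a bs * cf a t * prod_list (map2 cf bs ss) else 0)"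
        if len: "length bs = length ms" for a bs
      proof (cases "length ms = length ss")
        case True
        then show ?thesis
          using len by (simp add: lookup_elem_tensor lookup_dual_elem prod_list_dual_elem[OF len True])
      next
        case False
        then have "\<not> ?P" "length ss \<noteq> length (map2 dual_elem bs ms :: (_ \<Rightarrow>\<^sub>0 'k) list)"
          using len by auto
        then show ?thesis by (simp only: lookup_scl lookup_elem_tensor if_False mult_zero_right)
      qed
      then have "(\<Sum>a\<in>UNIV. \<Sum>bs\<in>{bs. length bs = length ms}.
          coef (scl (K ms a bs) (elem_tensor (dual_elem a (length ms)) (map2 dual_elem bs ms))) (t, ss)) =
        (\<Sum>a\<in>UNIV. \<Sum>bs\<in>{bs. length bs = length ms}.
          if ?P then K ms a bs * cf a t * prod_list (map2 cf bs ss) else 0)"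
        by (intro sum.cong refl) simp
      then show "(\<Sum>a\<in>UNIV. \<Sum>bs\<in>{bs. length bs = length ms}.
        coef (scl (K ms a bs) (elem_tensor (dual_elem a (length ms)) (map2 dual_elem bs ms))) (t, ss)) =
        (if ms = map leaves ss then
        if leaves t = length ss then (\<Sum>a\<in>UNIV. \<Sum>bs\<in>{bs. length bs = length ms}.
           K ms a bs * cf a t * prod_list (map2 cf bs ss)) else 0 else 0)"
        by (cases "ms = map leaves ss"; cases "leaves t = length ss") simp_all
    qed
    also have "\<dots> = (if map leaves ss \<in> S \<and> leaves t = length ss then cut_sign sdeg t ss * cf c (full_graft t ss) else 0)"
      using K[of t "map leaves ss" ss] by (simp add: S_def)
    also have "\<dots> = coef y (t, ss)"
    proof (cases "leaves t = length ss")
      case True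
      then have "leaves (full_graft t ss) = sum_list (map leaves ss)"
        by (simp add: leaves_full_graft)
      moreover have "coef y (t, ss) = 0" if "map leaves ss \<notin> S"
        using that unfolding S_def by (force simp: in_keys_iff)
      ultimately show ?thesis
        using S[of "map leaves ss"] True by (simp add: y_def lookup_decomp lookup_dual_elem)
    qed (auto simp: y_def lookup_decomp)
    finally show "coef y (t, ss) = coef ?z (t, ss)" by simp
  qed
  moreover have "elem_tensor (dual_elem a (length ms)) (map2 dual_elem bs ms) \<in> (comp_prod dual_span n :: (_ \<Rightarrow>\<^sub>0 'k) set)"
    if "ms \<in> S" "length bs = length ms" for ms a bs
    unfolding comp_prod_def
  proof (intro scl.span_base CollectI exI conjI)
    show "sum_list ms = n" using that S by blast
    show "dual_elem a (length ms) \<in> (dual_span (length (map2 dual_elem bs ms :: (_ \<Rightarrow>\<^sub>0 'k) list)) :: (_ \<Rightarrow>\<^sub>0 'k) set)"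
      using that(2) dual_elem_in_span by simp
    show "list_all2 (\<lambda>b m. b \<in> dual_span m) (map2 dual_elem bs ms) ms"
      using that(2) by (auto simp: list_all2_conv_all_nth dual_elem_in_span)
  qed simp
  moreover have "scl.subspace (comp_prod dual_span n :: (_ \<Rightarrow>\<^sub>0 'k) set)"
    by (simp add: comp_prod_def)
  ultimately show ?thesis
    unfolding y_def[symmetric]
    by (simp only:) (intro scl.subspace_sum scl.subspace_scale; simp)
qed

lemma part_subspace: "scl.subspace S \<Longrightarrow> scl.subspace {x. part P x \<in> S}"
  unfolding part_def by (rule lin_subspace_preimage)

lemma part_eqI: "(\<And>t. t \<in> Poly_Mapping.keys x \<Longrightarrow> P t) \<Longrightarrow> part P x = x"
  by (rule poly_mapping_eqI) (auto simp: lookup_part in_keys_iff)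

lemma part_eq_0: "(\<And>t. t \<in> Poly_Mapping.keys x \<Longrightarrow> \<not> P t) \<Longrightarrow> part P x = 0"
  by (rule poly_mapping_eqI) (auto simp: lookup_part in_keys_iff)

text \<open>Each dual element is homogeneous, so a degree part of it is the element itself or 0.
  Closure under decomposition is \<open>decomp_dual_elem\<close>, extended linearly.\<close>

lemma sub_cooperad_dual_span: "sub_cooperad agd_arity sdeg (dual_span :: nat \<Rightarrow> (_ \<Rightarrow>\<^sub>0 'k::field) set)"
  unfolding sub_cooperad_def
proof (intro allI conjI)
  fix n
  show sub: "scl.subspace (dual_span n :: (_ \<Rightarrow>\<^sub>0 'k) set)"
    by (simp add: dual_span_def)
  show "dual_span n \<subseteq> (tree_mod agd_arity n :: (_ \<Rightarrow>\<^sub>0 'k) set)"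
    by (intro dual_span_induct subspace_tree_mod) (auto simp: tree_mod_def dest: keys_dual_elem)
  have "dual_span n \<subseteq> {x :: _ \<Rightarrow>\<^sub>0 'k. decomp sdeg x \<in> comp_prod dual_span n}"
    using decomp_dual_elem unfolding decomp_def
    by (intro dual_span_induct lin_subspace_preimage CollectI) (simp_all add: comp_prod_def)
  then show "\<forall>x\<in>dual_span n. decomp sdeg (x :: _ \<Rightarrow>\<^sub>0 'k) \<in> comp_prod dual_span n" by blast
  have "dual_span n \<subseteq> {x :: _ \<Rightarrow>\<^sub>0 'k. part (\<lambda>t. tdeg sdeg t = d) x \<in> dual_span n}" for d
  proof (intro dual_span_induct part_subspace sub CollectI)
    fix c
    have "tdeg sdeg t = int n - (if c = GM then 1 else 0)" if "t \<in> Poly_Mapping.keys (dual_elem c n :: _ \<Rightarrow>\<^sub>0 'k)" for t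
      using keys_dual_elem[OF that] by (auto simp: tdeg_sdeg split: if_splits)
    then have "part (\<lambda>t. tdeg sdeg t = d) (dual_elem c n :: _ \<Rightarrow>\<^sub>0 'k) \<in> {0, dual_elem c n}"
      by (cases "d = int n - (if c = GM then 1 else 0)") (auto intro: part_eqI part_eq_0)
    then show "part (\<lambda>t. tdeg sdeg t = d) (dual_elem c n :: _ \<Rightarrow>\<^sub>0 'k) \<in> dual_span n"
      using sub dual_elem_in_span[of c n, where 'k = 'k] by (auto intro: scl.subspace_0)
  qed
  then show "\<forall>x\<in>dual_span n. \<forall>d. part (\<lambda>t. tdeg sdeg t = d) (x :: _ \<Rightarrow>\<^sub>0 'k) \<in> dual_span n" by blast
qed

section \<open>Corelations in weight two\<close>

lemma lin_bas [simp]: "lin f (bas b) = f b"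
  by (simp add: lin_def)

lemma lin_diff: "lin f (x - y) = lin f x - lin f y"
  using lin_add[of f "x - y" y] by (simp add: algebra_simps)

definition rel_assoc :: "agd_gen tree \<Rightarrow>\<^sub>0 'k::field" where
  "rel_assoc = bas (Node GM [Node GM [Leaf, Leaf], Leaf]) - bas (Node GM [Leaf, Node GM [Leaf, Leaf]])"

definition rel_der :: "agd_gen \<Rightarrow> agd_gen tree \<Rightarrow>\<^sub>0 'k::field" where
  "rel_der g = bas (Node g [Node GM [Leaf, Leaf]]) - bas (Node GM [Node g [Leaf], Leaf]) -
     bas (Node GM [Leaf, Node GH [Leaf]])"

lemma agd_relations_eq: "agd_relations = scl.span {rel_assoc, rel_der GH, rel_der GD}"
  by (simp add: agd_relations_def Let_def corolla_def pcomp_def bilin_def rel_assoc_def rel_der_def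
      agd_degree_def numeral_2_eq_2)

text \<open>All generators have degree 0, so moving the second suspension past the root label costs
  no sign.\<close>

lemma suspend2_agd_relations:
  "suspend2 agd_degree ` agd_relations = (agd_relations :: (_ \<Rightarrow>\<^sub>0 'k::field) set)"
proof -
  have "scl.subspace {x :: _ \<Rightarrow>\<^sub>0 'k. suspend2 agd_degree x = x}"
    by (auto simp: scl.subspace_def suspend2_def lin_add lin_scl)
  then have "agd_relations \<subseteq> {x :: _ \<Rightarrow>\<^sub>0 'k. suspend2 agd_degree x = x}"
    unfolding agd_relations_eq
    by (rule scl.span_minimal[rotated])
      (auto simp: suspend2_def lin_diff rel_assoc_def rel_der_def agd_degree_def)
  then show ?thesis by force
qed

lemma weight_1_trees:
  "wf_tree agd_arity t \<Longrightarrow> weight t = 1 \<Longrightarrow> t \<in> {Node GH [Leaf], Node GD [Leaf], Node GM [Leaf, Leaf]}"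
  and weight_0_trees: "weight t = 0 \<Longrightarrow> t = Leaf"
proof -
  show 0: "t = Leaf" if "weight t = 0" for t :: "agd_gen tree"
    using that by (cases t) auto
  show "wf_tree agd_arity t \<Longrightarrow> weight t = 1 \<Longrightarrow> t \<in> {Node GH [Leaf], Node GD [Leaf], Node GM [Leaf, Leaf]}"
    by (induction t rule: agd_tree_induct) (auto dest: 0)
qed

definition weight_2_trees :: "agd_gen tree set" where
  "weight_2_trees = (\<Union>s\<in>{Node GH [Leaf], Node GD [Leaf], Node GM [Leaf, Leaf]}.
     {Node GH [s], Node GD [s], Node GM [s, Leaf], Node GM [Leaf, s]})"

lemma weight_2_treesI: "wf_tree agd_arity t \<Longrightarrow> weight t = 2 \<Longrightarrow> t \<in> weight_2_trees"
proof (induction t rule: agd_tree_induct)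
  case (H t)
  then show ?case using weight_1_trees[of t] by (auto simp: weight_2_trees_def)
next
  case (D t)
  then show ?case using weight_1_trees[of t] by (auto simp: weight_2_trees_def)
next
  case (M t u)
  then have "weight t = 0 \<and> weight u = 1 \<or> weight t = 1 \<and> weight u = 0" by auto
  then show ?case
    using M.prems weight_1_trees[of t] weight_1_trees[of u] weight_0_trees[of t] weight_0_trees[of u]
    by (auto simp: weight_2_trees_def)
qed auto

text \<open>Both sides are supported on the twelve trees of \<open>weight_2_trees\<close> and are
  compared there one by one. The factor -1 appears because the right comb has coefficient 1 in the
  dual element and -1 in \<open>rel_assoc\<close>, and similarly for \<open>rel_der\<close>.\<close>

lemma dual_elem_weight_2:
  "dual_elem GM 3 = scl (-1) (rel_assoc :: _ \<Rightarrow>\<^sub>0 'k::field)"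
  "c \<noteq> GM \<Longrightarrow> dual_elem c 2 = scl (-1) (rel_der c :: _ \<Rightarrow>\<^sub>0 'k)"
proof -
  have eqI: "x = y" if "\<And>t. t \<in> weight_2_trees \<Longrightarrow> coef x t = coef y t"
    "\<And>t. t \<notin> weight_2_trees \<Longrightarrow> coef x t = 0 \<and> coef y t = 0" for x y :: "agd_gen tree \<Rightarrow>\<^sub>0 'k"
    using that by (intro poly_mapping_eqI) metis
  have out: "coef (dual_elem c n) t = (0 :: 'k)" if "t \<notin> weight_2_trees" "n = (if c = GM then 3 else 2)" for c n t
  proof (rule ccontr)
    assume "coef (dual_elem c n) t \<noteq> (0 :: 'k)"
    then have "t \<in> Poly_Mapping.keys (dual_elem c n :: _ \<Rightarrow>\<^sub>0 'k)"
      by (simp add: in_keys_iff)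
    from keys_dual_elem[OF this] that show False
      by (auto dest!: weight_2_treesI split: if_splits)
  qed
  show "dual_elem GM 3 = scl (-1) (rel_assoc :: _ \<Rightarrow>\<^sub>0 'k)"
  proof (rule eqI)
    fix t assume "t \<in> weight_2_trees"
    then show "coef (dual_elem GM 3) t = coef (scl (-1) (rel_assoc :: _ \<Rightarrow>\<^sub>0 'k)) t"
      unfolding weight_2_trees_def
      by (auto simp: rel_assoc_def lookup_dual_elem lookup_minus lookup_bas)
  next
    fix t assume t: "t \<notin> weight_2_trees"
    then show "coef (dual_elem GM 3) t = (0::'k) \<and> coef (scl (-1) (rel_assoc :: _ \<Rightarrow>\<^sub>0 'k)) t = 0"
      using out[OF t, of 3 GM]
      by (auto simp: weight_2_trees_def rel_assoc_def lookup_minus lookup_bas)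
  qed
  show "dual_elem c 2 = scl (-1) (rel_der c :: _ \<Rightarrow>\<^sub>0 'k)" if "c \<noteq> GM"
  proof (rule eqI)
    fix t assume "t \<in> weight_2_trees"
    then show "coef (dual_elem c 2) t = coef (scl (-1) (rel_der c :: _ \<Rightarrow>\<^sub>0 'k)) t"
      unfolding weight_2_trees_def using that
      by (cases c) (auto simp: rel_der_def lookup_dual_elem lookup_minus lookup_bas)
  next
    fix t assume t: "t \<notin> weight_2_trees"
    then show "coef (dual_elem c 2) t = (0::'k) \<and> coef (scl (-1) (rel_der c :: _ \<Rightarrow>\<^sub>0 'k)) t = 0"
      using out[OF t, of 2 c] that
      by (cases c) (auto simp: weight_2_trees_def rel_der_def lookup_minus lookup_bas)
  qed
qed

text \<open>Each dual element is concentrated in one weight. It survives the projection in one arity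
  only, and there it is a multiple of a relation.\<close>

lemma corelations_hold_dual_span:
  "corelations_hold agd_relations (dual_span :: nat \<Rightarrow> (_ \<Rightarrow>\<^sub>0 'k::field) set)"
  unfolding corelations_hold_def
proof (intro allI)
  fix n
  have sub: "scl.subspace (agd_relations :: (_ \<Rightarrow>\<^sub>0 'k) set)"
    by (simp add: agd_relations_eq)
  have rels: "rel_assoc \<in> (agd_relations :: (_ \<Rightarrow>\<^sub>0 'k) set)"
    "c \<noteq> GM \<Longrightarrow> rel_der c \<in> (agd_relations :: (_ \<Rightarrow>\<^sub>0 'k) set)" for c
    unfolding agd_relations_eq by (cases c; auto intro: scl.span_base)+
  have "dual_span n \<subseteq> {x :: _ \<Rightarrow>\<^sub>0 'k. part (\<lambda>t. weight t = 2) x \<in> agd_relations}"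
  proof (intro dual_span_induct part_subspace sub CollectI)
    fix c
    show "part (\<lambda>t. weight t = 2) (dual_elem c n :: _ \<Rightarrow>\<^sub>0 'k) \<in> agd_relations"
    proof (cases "n = (if c = GM then 3 else 2)")
      case True
      then have "part (\<lambda>t. weight t = 2) (dual_elem c n :: _ \<Rightarrow>\<^sub>0 'k) = dual_elem c n"
        by (intro part_eqI) (auto dest!: keys_dual_elem split: if_splits)
      also have "\<dots> \<in> agd_relations"
        using True dual_elem_weight_2(1)[where 'k = 'k] dual_elem_weight_2(2)[of c, where 'k = 'k] rels scl.subspace_neg[OF sub]
        by (cases "c = GM") auto
      finally show ?thesis .
    next
      case False
      then have "part (\<lambda>t. weight t = 2) (dual_elem c n :: _ \<Rightarrow>\<^sub>0 'k) = 0"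
        by (intro part_eq_0) (auto dest!: keys_dual_elem split: if_splits)
      then show ?thesis using scl.subspace_0[OF sub] by simp
    qed
  qed
  then show "\<forall>x\<in>dual_span n. part (\<lambda>t. weight t = 2) (x :: _ \<Rightarrow>\<^sub>0 'k) \<in> agd_relations" by blast
qed

text \<open>The equations express the coefficients of the other nine trees of weight two by those of
  the right comb and of the two trees with a unary root below \<open>GM\<close>. The tree with
  \<open>GH\<close> on the right leaf occurs in both derivation relations, hence the two terms in
  its equation.\<close>

lemma coef_agd_relations:
  assumes "z \<in> (agd_relations :: (_ \<Rightarrow>\<^sub>0 'k::field) set)"
  shows "coef z (Node GM [Node GM [Leaf, Leaf], Leaf]) = - coef z (Node GM [Leaf, Node GM [Leaf, Leaf]])"
    and "coef z (Node GM [Node GH [Leaf], Leaf]) = - coef z (Node GH [Node GM [Leaf, Leaf]])"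
    and "coef z (Node GM [Node GD [Leaf], Leaf]) = - coef z (Node GD [Node GM [Leaf, Leaf]])"
    and "coef z (Node GM [Leaf, Node GH [Leaf]]) =
      - coef z (Node GH [Node GM [Leaf, Leaf]]) - coef z (Node GD [Node GM [Leaf, Leaf]])"
    and "coef z (Node GM [Leaf, Node GD [Leaf]]) = 0"
    and "coef z (Node g [Node g' [Leaf]]) = 0"
proof -
  define T where "T = {z :: _ \<Rightarrow>\<^sub>0 'k.
    coef z (Node GM [Node GM [Leaf, Leaf], Leaf]) = - coef z (Node GM [Leaf, Node GM [Leaf, Leaf]]) \<and>
    coef z (Node GM [Node GH [Leaf], Leaf]) = - coef z (Node GH [Node GM [Leaf, Leaf]]) \<and>
    coef z (Node GM [Node GD [Leaf], Leaf]) = - coef z (Node GD [Node GM [Leaf, Leaf]]) \<and>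
    coef z (Node GM [Leaf, Node GH [Leaf]]) =
      - coef z (Node GH [Node GM [Leaf, Leaf]]) - coef z (Node GD [Node GM [Leaf, Leaf]]) \<and>
    coef z (Node GM [Leaf, Node GD [Leaf]]) = 0 \<and>
    (\<forall>g g'. coef z (Node g [Node g' [Leaf]]) = 0)}"
  have "scl.subspace T"
    unfolding scl.subspace_def T_def by (auto simp: lookup_add right_diff_distrib)
  moreover have "{rel_assoc, rel_der GH, rel_der GD} \<subseteq> T"
    by (simp add: T_def rel_assoc_def rel_der_def lookup_minus lookup_bas)
  ultimately have "z \<in> T"
    using assms scl.span_minimal unfolding agd_relations_eq by blast
  then show "coef z (Node GM [Node GM [Leaf, Leaf], Leaf]) = - coef z (Node GM [Leaf, Node GM [Leaf, Leaf]])"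
    and "coef z (Node GM [Node GH [Leaf], Leaf]) = - coef z (Node GH [Node GM [Leaf, Leaf]])"
    and "coef z (Node GM [Node GD [Leaf], Leaf]) = - coef z (Node GD [Node GM [Leaf, Leaf]])"
    and "coef z (Node GM [Leaf, Node GH [Leaf]]) =
      - coef z (Node GH [Node GM [Leaf, Leaf]]) - coef z (Node GD [Node GM [Leaf, Leaf]])"
    and "coef z (Node GM [Leaf, Node GD [Leaf]]) = 0"
    and "coef z (Node g [Node g' [Leaf]]) = 0"
    unfolding T_def by blast+
qed

lemma cut_sign_nonzero:
  "cut_sign dg t ss \<noteq> (0 :: 'k::field)" "cut_sign_list dg ts ss \<noteq> (0 :: 'k)"
  by (induction t and ts arbitrary: ss and ss rule: tree_forest_induct) auto

section \<open>Slices of sub-cooperads and the upper bound\<close>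

text \<open>Contracting the upper factors against the forest \<open>ss\<close> sends an elementary
  tensor to a multiple of its lower factor, hence maps \<open>comp_prod C n\<close> into
  \<open>C (length ss)\<close>.\<close>

lemma lower_slice:
  assumes C: "sub_cooperad ar dg C" and x: "x \<in> C n"
  shows "\<exists>z\<in>C (length ss). \<forall>t. leaves t = length ss \<longrightarrow>
    coef z t = cut_sign dg t ss * (coef x (full_graft t ss) :: 'k::field)"
proof -
  define f :: "'a tree \<times> 'a tree list \<Rightarrow> _ \<Rightarrow>\<^sub>0 'k" where
    "f = (\<lambda>(t, us). if us = ss then bas t else 0)"
  have f: "coef (lin f y) t = coef y (t, ss)" for y t
    by (subst lookup_lin_unique[where ?a0.0 = "(t, ss)"]) (auto simp: f_def lookup_bas split: if_splits)
  have sub: "scl.subspace (C m)" for m using C by (simp add: sub_cooperad_def)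
  have "comp_prod C n \<subseteq> {y. lin f y \<in> C (length ss)}"
    unfolding comp_prod_def
  proof (rule scl.span_minimal[OF _ lin_subspace_preimage[OF sub]], safe)
    fix a and bs :: "('a tree \<Rightarrow>\<^sub>0 'k) list" and ms assume a: "a \<in> C (length bs)"
    have "lin f (elem_tensor a bs) =
        scl (if length ss = length bs then prod_list (map2 coef bs ss) else 0) a"
      by (rule poly_mapping_eqI) (simp add: f lookup_elem_tensor)
    then show "lin f (elem_tensor a bs) \<in> C (length ss)"
      using a scl.subspace_scale[OF sub] scl.subspace_0[OF sub] by auto
  qed
  moreover have "decomp dg x \<in> comp_prod C n"
    using C x by (simp add: sub_cooperad_def)
  ultimately have "lin f (decomp dg x) \<in> C (length ss)"
    by blast
  then show ?thesis
    by (rule rev_bexI) (simp add: f lookup_decomp)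
qed

text \<open>The same with the lower factor and all upper factors but one contracted: an elementary
  tensor goes to a multiple of the remaining upper factor.\<close>

lemma upper_slice:
  assumes C: "sub_cooperad ar dg C" and x: "x \<in> C n" and t: "leaves t = length pre + Suc (length suf)"
  shows "\<exists>z\<in>C m. \<forall>u. leaves u = m \<longrightarrow>
    coef z u = cut_sign dg t (pre @ u # suf) * (coef x (full_graft t (pre @ u # suf)) :: 'k::field)"
proof -
  define f :: "'a tree \<times> 'a tree list \<Rightarrow> _ \<Rightarrow>\<^sub>0 'k" where
    \<comment> \<open>The arity of the open slot is fixed to \<open>m\<close> as well, so a factor
      of another arity in that slot is sent to 0 and the result stays in \<open>C m\<close>.\<close>
    "f = (\<lambda>(t', us). if t' = t \<and> (\<exists>u. us = pre @ u # suf \<and> leaves u = m) then bas (us ! length pre) else 0)"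
  have f: "coef (lin f y) u = (if leaves u = m then coef y (t, pre @ u # suf) else 0)" for y u
    by (subst lookup_lin_unique[where ?a0.0 = "(t, pre @ u # suf)"])
      (auto simp: f_def lookup_bas split: if_splits)
  have sub: "scl.subspace (C m)" for m using C by (simp add: sub_cooperad_def)
  have "comp_prod C n \<subseteq> {y. lin f y \<in> C m}"
    unfolding comp_prod_def
  proof (rule scl.span_minimal[OF _ lin_subspace_preimage[OF sub]], safe)
    fix a and bs :: "('a tree \<Rightarrow>\<^sub>0 'k) list" and ms assume bs: "list_all2 (\<lambda>b m. b \<in> C m) bs ms"
    show "lin f (elem_tensor a bs) \<in> C m"
    proof (cases "length bs = length pre + Suc (length suf)")
      case True
      define bp b bq where "bp = take (length pre) bs" and "b = bs ! length pre"
        and "bq = drop (Suc (length pre)) bs"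
      have bs_eq: "bs = bp @ b # bq" and len: "length bp = length pre"
        using True by (simp_all add: bp_def b_def bq_def id_take_nth_drop)
      obtain m' where m': "b \<in> C m'"
        using bs unfolding bs_eq by (auto simp: list_all2_append1 list_all2_Cons1)
      moreover have "C m' \<subseteq> tree_mod ar m'"
        using C by (simp add: sub_cooperad_def)
      ultimately have "b \<in> tree_mod ar m'" by blast
      then have b: "coef b u = 0" if "leaves u \<noteq> m'" for u
        using that by (auto simp: tree_mod_def in_keys_iff)
      have "lin f (elem_tensor a bs) = scl (if m' = m then
          coef a t * prod_list (map2 coef bp pre) * prod_list (map2 coef bq suf) else 0) b"
        using True len b by (intro poly_mapping_eqI) (auto simp: f lookup_elem_tensor bs_eq)
      then show ?thesis
        using m' scl.subspace_scale[OF sub] scl.subspace_0[OF sub] by auto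
    next
      case False
      then have "lin f (elem_tensor a bs) = 0"
        by (intro poly_mapping_eqI) (simp add: f lookup_elem_tensor)
      then show ?thesis using scl.subspace_0[OF sub] by simp
    qed
  qed
  moreover have "decomp dg x \<in> comp_prod C n"
    using C x by (simp add: sub_cooperad_def)
  ultimately have "lin f (decomp dg x) \<in> C m"
    by blast
  then show ?thesis
    by (rule rev_bexI) (simp add: f lookup_decomp t)
qed

section \<open>Vanishing relations at the root of a tree\<close>

locale agd_cooperad =
  fixes C :: "nat \<Rightarrow> (agd_gen tree \<Rightarrow>\<^sub>0 'k::field) set"
  assumes sub_cooperad: "sub_cooperad agd_arity sdeg C"
    and corelations: "corelations_hold agd_relations C"
begin

text \<open>Only vanishing is recorded, so the Koszul signs of the slices can be ignored.\<close>

lemma lower_slice_vanish: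
  assumes "x \<in> C n"
  obtains z where "z \<in> C (length ss)"
    and "\<And>t. leaves t = length ss \<Longrightarrow> coef z t = 0 \<longleftrightarrow> coef x (full_graft t ss) = 0"
proof -
  obtain z where "z \<in> C (length ss)"
    "\<forall>t. leaves t = length ss \<longrightarrow> coef z t = cut_sign sdeg t ss * coef x (full_graft t ss)"
    using lower_slice[OF sub_cooperad assms] by blast
  then show ?thesis
    using that by (simp add: cut_sign_nonzero)
qed

lemma upper_slice_vanish:
  assumes "x \<in> C n" "leaves t = length pre + Suc (length suf)"
  obtains z where "z \<in> C m"
    and "\<And>u. leaves u = m \<Longrightarrow> coef z u = 0 \<longleftrightarrow> coef x (full_graft t (pre @ u # suf)) = 0"
proof -
  obtain z where "z \<in> C m"
    "\<forall>u. leaves u = m \<longrightarrow> coef z u = cut_sign sdeg t (pre @ u # suf) * coef x (full_graft t (pre @ u # suf))"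
    using upper_slice[OF sub_cooperad assms] by blast
  then show ?thesis
    using that by (simp add: cut_sign_nonzero)
qed

lemma coef_relations:
  assumes "z \<in> C m"
  shows "coef z (Node GM [Node GM [Leaf, Leaf], Leaf]) = - coef z (Node GM [Leaf, Node GM [Leaf, Leaf]])"
    and "coef z (Node GM [Node GH [Leaf], Leaf]) = - coef z (Node GH [Node GM [Leaf, Leaf]])"
    and "coef z (Node GM [Node GD [Leaf], Leaf]) = - coef z (Node GD [Node GM [Leaf, Leaf]])"
    and "coef z (Node GM [Leaf, Node GH [Leaf]]) =
      - coef z (Node GH [Node GM [Leaf, Leaf]]) - coef z (Node GD [Node GM [Leaf, Leaf]])"
    and "coef z (Node GM [Leaf, Node GD [Leaf]]) = 0"
    and "coef z (Node g [Node g' [Leaf]]) = 0"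
proof -
  have "part (\<lambda>t. weight t = 2) z \<in> agd_relations"
    using assms corelations by (simp add: corelations_hold_def)
  from coef_agd_relations[OF this]
  show "coef z (Node GM [Node GM [Leaf, Leaf], Leaf]) = - coef z (Node GM [Leaf, Node GM [Leaf, Leaf]])"
    and "coef z (Node GM [Node GH [Leaf], Leaf]) = - coef z (Node GH [Node GM [Leaf, Leaf]])"
    and "coef z (Node GM [Node GD [Leaf], Leaf]) = - coef z (Node GD [Node GM [Leaf, Leaf]])"
    and "coef z (Node GM [Leaf, Node GH [Leaf]]) =
      - coef z (Node GH [Node GM [Leaf, Leaf]]) - coef z (Node GD [Node GM [Leaf, Leaf]])"
    and "coef z (Node GM [Leaf, Node GD [Leaf]]) = 0"
    and "coef z (Node g [Node g' [Leaf]]) = 0"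
    by (simp_all add: lookup_part)
qed

text \<open>The equations in weight two apply to the lower slice at the forest of the subtrees
  \<open>u\<close>, \<open>v\<close>, \<open>w\<close>, and so hold around the root of a tree with
  anything on top.\<close>

lemma root_relations:
  assumes "x \<in> C n"
  shows "coef x (Node GM [u, Node GM [v, w]]) = 0 \<Longrightarrow> coef x (Node GM [Node GM [u, v], w]) = 0"
    and "c \<noteq> GM \<Longrightarrow> coef x (Node c [Node GM [u, v]]) = 0 \<Longrightarrow> coef x (Node GM [Node c [u], v]) = 0"
    and "coef x (Node GH [Node GM [u, v]]) = 0 \<Longrightarrow> coef x (Node GD [Node GM [u, v]]) = 0 \<Longrightarrow>
      coef x (Node GM [u, Node GH [v]]) = 0"
    and "coef x (Node GM [u, Node GD [v]]) = 0"
    and "coef x (Node g [Node g' [u]]) = 0"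
proof -
  obtain z where z: "z \<in> C 3"
    "\<And>t. leaves t = 3 \<Longrightarrow> coef z t = 0 \<longleftrightarrow> coef x (full_graft t [u, v, w]) = 0"
    using lower_slice_vanish[OF assms, of "[u, v, w]"] by (simp add: numeral_3_eq_3) metis
  show "coef x (Node GM [Node GM [u, v], w]) = 0" if "coef x (Node GM [u, Node GM [v, w]]) = 0"
    using that coef_relations(1)[OF z(1)] z(2)[of "Node GM [Node GM [Leaf, Leaf], Leaf]"]
      z(2)[of "Node GM [Leaf, Node GM [Leaf, Leaf]]"] by (simp add: take_Cons' drop_Cons')
next
  obtain z where z: "z \<in> C 2"
    "\<And>t. leaves t = 2 \<Longrightarrow> coef z t = 0 \<longleftrightarrow> coef x (full_graft t [u, v]) = 0"
    using lower_slice_vanish[OF assms, of "[u, v]"] by (simp add: numeral_2_eq_2) metis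
  note rel = coef_relations[OF z(1)]
  note eq = z(2)[of "Node g [Node GM [Leaf, Leaf]]" for g] z(2)[of "Node GM [Node g [Leaf], Leaf]" for g]
    z(2)[of "Node GM [Leaf, Node g [Leaf]]" for g]
  show "coef x (Node GM [Node c [u], v]) = 0" if "c \<noteq> GM" "coef x (Node c [Node GM [u, v]]) = 0"
    using that rel eq(1)[of c] eq(2)[of c] by (cases c) (simp_all add: take_Cons' drop_Cons')
  show "coef x (Node GM [u, Node GH [v]]) = 0"
    if "coef x (Node GH [Node GM [u, v]]) = 0" "coef x (Node GD [Node GM [u, v]]) = 0"
    using that rel eq(1)[of GH] eq(1)[of GD] eq(3)[of GH] by (simp add: take_Cons' drop_Cons')
  show "coef x (Node GM [u, Node GD [v]]) = 0"
    using rel eq(3)[of GD] by (simp add: take_Cons' drop_Cons')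
next
  obtain z where z: "z \<in> C 1"
    "\<And>t. leaves t = 1 \<Longrightarrow> coef z t = 0 \<longleftrightarrow> coef x (full_graft t [u]) = 0"
    using lower_slice_vanish[OF assms, of "[u]"] by simp metis
  show "coef x (Node g [Node g' [u]]) = 0"
    using coef_relations(6)[OF z(1)] z(2)[of "Node g [Node g' [Leaf]]"] by simp
qed

text \<open>With the root and one child fixed, the coefficient as a function of the other child is,
  up to a nonzero factor, that of an element of the cooperad. Induction hypotheses can thus be
  applied to subtrees.\<close>

lemma right_subtree_slice:
  assumes "x \<in> C n"
  obtains z where "z \<in> C m" "\<And>u. leaves u = m \<Longrightarrow> coef z u = 0 \<longleftrightarrow> coef x (Node GM [s, u]) = 0"
proof -
  obtain z where "z \<in> C m"
    "\<And>u. leaves u = m \<Longrightarrow> coef z u = 0 \<longleftrightarrow> coef x (full_graft (Node GM [Leaf, Leaf]) ([s] @ u # [])) = 0"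
    using upper_slice_vanish[OF assms, of "Node GM [Leaf, Leaf]" "[s]" "[]" m] by auto
  then show ?thesis using that by simp
qed

lemma left_subtree_slice:
  assumes "x \<in> C n"
  obtains z where "z \<in> C m" "\<And>u. leaves u = m \<Longrightarrow> coef z u = 0 \<longleftrightarrow> coef x (Node GM [u, s]) = 0"
proof -
  obtain z where "z \<in> C m"
    "\<And>u. leaves u = m \<Longrightarrow> coef z u = 0 \<longleftrightarrow> coef x (full_graft (Node GM [Leaf, Leaf]) ([] @ u # [s])) = 0"
    using upper_slice_vanish[OF assms, of "Node GM [Leaf, Leaf]" "[]" "[s]" m] by auto
  then show ?thesis using that by simp
qed

lemma unary_subtree_slice:
  assumes "x \<in> C n"
  obtains z where "z \<in> C m" "\<And>u. leaves u = m \<Longrightarrow> coef z u = 0 \<longleftrightarrow> coef x (Node g [u]) = 0"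
proof -
  obtain z where "z \<in> C m"
    "\<And>u. leaves u = m \<Longrightarrow> coef z u = 0 \<longleftrightarrow> coef x (full_graft (Node g [Leaf]) ([] @ u # [])) = 0"
    using upper_slice_vanish[OF assms, of "Node g [Leaf]" "[]" "[]" m] by auto
  then show ?thesis using that by simp
qed

end

section \<open>Normal forms and the upper bound\<close>

fun comb :: "nat \<Rightarrow> agd_gen tree" where
  "comb 0 = Leaf"
| "comb (Suc k) = Node GM [Leaf, comb k]"

definition normal_form :: "agd_gen \<Rightarrow> nat \<Rightarrow> agd_gen tree" where
  "normal_form c k = (if c = GM then comb k else Node c [comb k])"

lemma leaves_comb [simp]: "leaves (comb k) = Suc k"
  by (induction k) auto

lemma leaves_normal_form [simp]: "leaves (normal_form c k) = Suc k"
  by (simp add: normal_form_def)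

text \<open>The dual elements evaluated on the normal forms give a diagonal matrix with entries 1 or
  -1. This yields both linear independence and the correction term in
  \<open>subset_dual_span\<close>.\<close>

lemma cf_normal_form:
  "cf a (normal_form b k) = (if a = b then if a = GM then 1 else (-1) ^ k else 0 :: 'k::field)"
proof -
  have "cf a (comb k) = (if a = GM then 1 else 0 :: 'k)" for a
    by (induction k arbitrary: a) (auto split: agd_gen.split)
  then show ?thesis
    by (cases b) (auto simp: normal_form_def)
qed

lemma leaves_pos: "wf_tree agd_arity t \<Longrightarrow> 1 \<le> leaves t"
  by (induction t rule: agd_tree_induct) auto

context agd_cooperad
begin

text \<open>A unary vertex on the right child of the root either contributes 0, for
  \<open>GD\<close>, or is moved below the root, for \<open>GH\<close>, which produces normal
  forms.\<close>

lemma unit_comb: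
  assumes "x \<in> C (Suc (Suc j))" "\<And>c. coef x (normal_form c (Suc j)) = 0"
  shows "coef x (Node GM [Leaf, normal_form b j]) = 0"
proof -
  have "coef x (normal_form GM (Suc j)) = 0" "coef x (normal_form GH (Suc j)) = 0"
    "coef x (normal_form GD (Suc j)) = 0"
    using assms(2) by simp_all
  then show ?thesis
    using root_relations(3,4)[OF assms(1), of Leaf "comb j"]
    by (cases b) (simp_all add: normal_form_def)
qed

text \<open>Induction on the left comb: associativity moves its lowest vertex to the root, leaving a
  single leaf on the left. The right subtree then has a shorter left comb and is handled by a
  slice.\<close>

lemma vanish_comb_normal_form:
  assumes "x \<in> C (Suc (Suc (i + j)))" "\<And>c. coef x (normal_form c (Suc (i + j))) = 0"
  shows "coef x (Node GM [comb i, normal_form b j]) = 0"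
  using assms
proof (induction i arbitrary: x j b)
  case 0
  then show ?case by (simp add: unit_comb)
next
  case (Suc i)
  obtain z where z: "z \<in> C (Suc (Suc (i + j)))"
    "\<And>u. leaves u = Suc (Suc (i + j)) \<Longrightarrow> coef z u = 0 \<longleftrightarrow> coef x (Node GM [Leaf, u]) = 0"
    using right_subtree_slice[OF Suc.prems(1)] by blast
  have "coef z (normal_form c (Suc (i + j))) = 0" for c
    using unit_comb[OF Suc.prems(1)[unfolded add_Suc] Suc.prems(2)[unfolded add_Suc]] by (simp add: z(2))
  then have "coef z (Node GM [comb i, normal_form b j]) = 0"
    by (rule Suc.IH[OF z(1)])
  moreover have "leaves (Node GM [comb i, normal_form b j]) = Suc (Suc (i + j))"
    by simp
  ultimately have "coef x (Node GM [Leaf, Node GM [comb i, normal_form b j]]) = 0"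
    by (simp only: z(2))
  then show ?case
    using root_relations(1)[OF Suc.prems(1)] by simp
qed

text \<open>A unary vertex at the root of the left subtree is moved below the binary root; slicing
  above it leaves the case of a left comb.\<close>

lemma vanish_normal_forms:
  assumes "x \<in> C (Suc (Suc (i + j)))" "\<And>c. coef x (normal_form c (Suc (i + j))) = 0"
  shows "coef x (Node GM [normal_form a i, normal_form b j]) = 0"
proof (cases "a = GM")
  case True
  then show ?thesis
    using vanish_comb_normal_form[OF assms] by (simp add: normal_form_def)
next
  case False
  obtain z where z: "z \<in> C (Suc (Suc (i + j)))"
    "\<And>u. leaves u = Suc (Suc (i + j)) \<Longrightarrow> coef z u = 0 \<longleftrightarrow> coef x (Node a [u]) = 0"
    using unary_subtree_slice[OF assms(1)] by blast
  \<comment> \<open>The tree is a normal form if \<open>c\<close> is \<open>GM\<close>; otherwise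
    two consecutive unary vertices make the coefficient 0.\<close>
  have "coef x (Node a [normal_form c (Suc (i + j))]) = 0" for c
    using assms(2)[of a] False root_relations(5)[OF assms(1)]
    by (cases "c = GM") (simp_all add: normal_form_def)
  then have "coef z (normal_form c (Suc (i + j))) = 0" for c
    by (simp add: z(2))
  then have "coef z (Node GM [comb i, normal_form b j]) = 0"
    by (rule vanish_comb_normal_form[OF z(1)])
  moreover have "leaves (Node GM [comb i, normal_form b j]) = Suc (Suc (i + j))"
    by simp
  ultimately have "coef x (Node a [Node GM [comb i, normal_form b j]]) = 0"
    by (simp only: z(2))
  then show ?thesis
    using root_relations(2)[OF assms(1) False] False by (simp add: normal_form_def)
qed

text \<open>Induction on the tree, for all elements of the cooperad at once. At a binary root the
  subtrees are replaced by normal forms one after the other, which reduces the claim to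
  \<open>vanish_normal_forms\<close>.\<close>

lemma vanish_tree:
  assumes "wf_tree agd_arity t" "leaves t = Suc k" "x \<in> C (Suc k)" "\<And>c. coef x (normal_form c k) = 0"
  shows "coef x t = 0"
proof -
  have unary: "coef x (Node g [t]) = 0"
    if IH: "\<And>z. z \<in> C (Suc k) \<Longrightarrow> (\<And>c. coef z (normal_form c k) = 0) \<Longrightarrow> coef z t = 0"
      and g: "g \<noteq> GM" and t: "leaves t = Suc k" and x: "x \<in> C (Suc k)" "\<And>c. coef x (normal_form c k) = 0"
    for g t k x
  proof -
    obtain z where z: "z \<in> C (Suc k)" "\<And>u. leaves u = Suc k \<Longrightarrow> coef z u = 0 \<longleftrightarrow> coef x (Node g [u]) = 0"
      using unary_subtree_slice[OF x(1)] by blast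
    have "coef x (Node g [normal_form c k]) = 0" for c
      using x(2)[of g] g root_relations(5)[OF x(1)] by (cases "c = GM") (simp_all add: normal_form_def)
    then have "coef z t = 0"
      by (intro IH z(1)) (simp add: z(2))
    with t show ?thesis by (simp add: z(2))
  qed
  show ?thesis
    using assms
  proof (induction t arbitrary: k x rule: agd_tree_induct)
    case Leaf
    then show ?case using Leaf.prems(4)[of GM] by (simp add: normal_form_def)
  next
    case (H t)
    then show ?case by (intro unary[of k]) auto
  next
    case (D t)
    then show ?case by (intro unary[of k]) auto
  next
    case (M t u)
    obtain i j where i: "leaves t = Suc i" and j: "leaves u = Suc j"
      using leaves_pos[of t] leaves_pos[of u] M.prems(1) by (metis One_nat_def Suc_le_D wf_tree.simps(2) list.set_intros)
    have k: "k = Suc (i + j)" using M.prems(2) by (simp add: i j)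
    have wf: "wf_tree agd_arity t" "wf_tree agd_arity u" using M.prems(1) by auto
    \<comment> \<open>First the left subtree is arbitrary and the right one a normal form;
      afterwards the left subtree is fixed and the right one varies.\<close>
    have "coef x (Node GM [t, normal_form b j]) = 0" for b
    proof -
      obtain z where z: "z \<in> C (Suc i)"
        "\<And>s. leaves s = Suc i \<Longrightarrow> coef z s = 0 \<longleftrightarrow> coef x (Node GM [s, normal_form b j]) = 0"
        using left_subtree_slice[OF M.prems(3)] by blast
      have "coef z (normal_form a i) = 0" for a
        using vanish_normal_forms[OF M.prems(3,4)[unfolded k]] by (simp add: z(2))
      from M.IH(1)[OF wf(1) i z(1) this] show ?thesis by (simp add: z(2) i)
    qed
    moreover obtain z where z: "z \<in> C (Suc j)"
      "\<And>s. leaves s = Suc j \<Longrightarrow> coef z s = 0 \<longleftrightarrow> coef x (Node GM [t, s]) = 0"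
      using right_subtree_slice[OF M.prems(3)] by blast
    ultimately have "coef z (normal_form b j) = 0" for b
      by simp
    from M.IH(2)[OF wf(2) j z(1) this] show ?case by (simp add: z(2) j)
  qed auto
qed

text \<open>Subtracting the combination of dual elements that agrees with \<open>x\<close> on the
  normal forms leaves an element that vanishes on them, hence everywhere.\<close>

lemma subset_dual_span:
  assumes "\<And>c. dual_elem c (Suc k) \<in> C (Suc k)"
  shows "C (Suc k) \<subseteq> dual_span (Suc k)"
proof
  fix x assume x: "x \<in> C (Suc k)"
  \<comment> \<open>The sign is the inverse of the diagonal entry in
    \<open>cf_normal_form\<close>.\<close>
  define b where "b c = (if c = GM then 1 else (-1) ^ k) * coef x (normal_form c k)" for c
  define w where "w = scl (b GM) (dual_elem GM (Suc k)) + scl (b GH) (dual_elem GH (Suc k)) +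
    scl (b GD) (dual_elem GD (Suc k))"
  have sub: "scl.subspace (C m)" "C m \<subseteq> tree_mod agd_arity m" for m
    using sub_cooperad by (simp_all add: sub_cooperad_def)
  have "w \<in> C (Suc k)"
    unfolding w_def by (intro scl.subspace_add scl.subspace_scale sub assms)
  then have xw: "x - w \<in> C (Suc k)"
    by (intro scl.subspace_diff sub x)
  have sq: "(-1) ^ k * ((-1) ^ k * y) = (y :: 'k)" for y
    by (cases "even k") simp_all
  have "coef (x - w) (normal_form c k) = 0" for c
    by (cases c) (simp_all add: lookup_minus w_def lookup_add lookup_dual_elem cf_normal_form b_def sq)
  then have vanish: "coef (x - w) t = 0" if "wf_tree agd_arity t" "leaves t = Suc k" for t
    by (intro vanish_tree[OF that xw])
  have mod: "x - w \<in> tree_mod agd_arity (Suc k)"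
    using xw sub(2) by blast
  have "coef (x - w) t = 0" for t
  proof (rule ccontr)
    assume nz: "coef (x - w) t \<noteq> 0"
    then have "t \<in> Poly_Mapping.keys (x - w)"
      by (simp only: in_keys_iff not_False_eq_True)
    with mod have "wf_tree agd_arity t" "leaves t = Suc k"
      unfolding tree_mod_def by blast+
    from vanish[OF this] nz show False by contradiction
  qed
  then have "x - w = 0"
    by (metis lookup_zero poly_mapping_eqI)
  moreover have "w \<in> dual_span (Suc k)"
    unfolding w_def dual_span_def
    by (intro scl.span_add scl.span_scale scl.span_base) auto
  ultimately show "x \<in> dual_span (Suc k)" by simp
qed

end

section \<open>The Koszul dual and its basis\<close>

text \<open>Universality puts the span inside the Koszul dual. The Koszul dual itself satisfies the
  assumptions of \<open>agd_cooperad\<close>, which gives the reverse inclusion.\<close>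

lemma koszul_dual_agd_eq:
  assumes "1 \<le> n"
  shows "koszul_dual agd n = (dual_span n :: (_ \<Rightarrow>\<^sub>0 'k::field) set)"
proof -
  note dual = koszul_dual_agd[where 'k = 'k, unfolded is_quadratic_cooperad_def suspend2_agd_relations]
  interpret agd_cooperad "koszul_dual agd :: nat \<Rightarrow> (_ \<Rightarrow>\<^sub>0 'k) set"
    using dual by unfold_locales blast+
  have sub: "dual_span m \<subseteq> (koszul_dual agd m :: (_ \<Rightarrow>\<^sub>0 'k) set)" for m
    using dual sub_cooperad_dual_span corelations_hold_dual_span by blast
  obtain k where n: "n = Suc k" using assms by (cases n) auto
  have "koszul_dual agd n \<subseteq> (dual_span n :: (_ \<Rightarrow>\<^sub>0 'k) set)"
    unfolding n using sub dual_elem_in_span by (intro subset_dual_span) blast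
  with sub show ?thesis by blast
qed

lemma dual_elem_basis:
  fixes n :: nat
  assumes "1 \<le> n"
  defines "B \<equiv> {dual_elem GM n, dual_elem GH n, dual_elem GD n :: _ \<Rightarrow>\<^sub>0 'k::field}"
  shows "distinct [dual_elem GM n, dual_elem GH n, dual_elem GD n :: _ \<Rightarrow>\<^sub>0 'k]"
    and "scl.independent B"
proof -
  obtain k where n: "n = Suc k" using assms by (cases n) auto
  have inj: "a = b" if "dual_elem a n = (dual_elem b n :: _ \<Rightarrow>\<^sub>0 'k)" for a b
  proof -
    have "coef (dual_elem a n) (normal_form a k) = (coef (dual_elem b n) (normal_form a k) :: 'k)"
      using that by simp
    then show ?thesis
      by (simp add: lookup_dual_elem n cf_normal_form split: if_splits)
  qed
  show "distinct [dual_elem GM n, dual_elem GH n, dual_elem GD n :: _ \<Rightarrow>\<^sub>0 'k]"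
    by (auto dest: inj)
  show "scl.independent B"
  \<comment> \<open>Evaluating the relation at the normal form of label \<open>c\<close> leaves only
    the term of \<open>dual_elem c n\<close>.\<close>
  proof (rule scl.independent_if_scalars_zero)
    fix f and x :: "agd_gen tree \<Rightarrow>\<^sub>0 'k"
    assume sum: "(\<Sum>y\<in>B. scl (f y) y) = 0" and "x \<in> B"
    then obtain c where x: "x = dual_elem c n" by (auto simp: B_def)
    have "coef y (normal_form c k) = 0" if "y \<in> B" "y \<noteq> x" for y
      using that by (auto simp: B_def x lookup_dual_elem n cf_normal_form)
    then have "coef (\<Sum>y\<in>B. scl (f y) y) (normal_form c k) =
        (\<Sum>y\<in>B. if y = x then f x * coef x (normal_form c k) else 0)"
      unfolding lookup_sum by (intro sum.cong) auto
    also have "\<dots> = f x * coef x (normal_form c k)"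
      using \<open>x \<in> B\<close> by (simp add: B_def)
    finally show "f x = 0"
      by (simp add: sum x lookup_dual_elem n cf_normal_form split: if_splits)
  qed (simp add: B_def)
qed

lemma homogeneous_dual_elem:
  "homogeneous sdeg (int n - (if c = GM then 1 else 0)) (dual_elem c n :: _ \<Rightarrow>\<^sub>0 'k::field)"
  unfolding homogeneous_def
  by (auto simp: tdeg_sdeg dest!: keys_dual_elem)

lemma counit_dual_elem: "counit (dual_elem c n) = (if c = GM \<and> n = 1 then 1 else 0)"
  by (simp add: counit_def lookup_dual_elem)

theorem proposition0p3:
  shows "\<exists>\<mu> h \<delta> :: nat \<Rightarrow> (agd_gen tree \<Rightarrow>\<^sub>0 'k::field_char_0). \<forall>n\<ge>1.
    distinct [\<mu> n, h n, \<delta> n] \<and>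
    scl.independent {\<mu> n, h n, \<delta> n} \<and>
    koszul_dual agd n = scl.span {\<mu> n, h n, \<delta> n} \<and>
    homogeneous (susp_degree agd_degree) (int n - 1) (\<mu> n) \<and>
    homogeneous (susp_degree agd_degree) (int n) (h n) \<and>
    homogeneous (susp_degree agd_degree) (int n) (\<delta> n) \<and>
    counit (\<mu> n) = (if n = 1 then 1 else 0) \<and>
    counit (h n) = 0 \<and>
    counit (\<delta> n) = 0 \<and>
    inf_decomp (susp_degree agd_degree) (\<mu> n) =
      (\<Sum>(p, q, r) \<in> {(p, q, r). p + q + r = n \<and> 1 \<le> q}.
         scl ((-1) ^ (r * (q - 1))) (\<mu> (p + r + 1) \<boxtimes>\<^bsub>p + 1\<^esub> \<mu> q)) \<and>
    inf_decomp (susp_degree agd_degree) (h n) =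
      (\<Sum>(p, q, r) \<in> {(p, q, r). p + q + r = n \<and> 1 \<le> q}.
         scl ((-1) ^ (r * (q - 1))) (\<mu> (p + r + 1) \<boxtimes>\<^bsub>p + 1\<^esub> h q)) +
      (\<Sum>(p, q, r) \<in> {(p, q, r). p + q + r = n \<and> 1 \<le> q}.
         scl ((-1) ^ ((r + 1) * (q - 1))) (h (p + r + 1) \<boxtimes>\<^bsub>p + 1\<^esub> \<mu> q)) \<and>
    inf_decomp (susp_degree agd_degree) (\<delta> n) =
      (\<Sum>(p, q, r) \<in> {(p, q, r). p + q + r = n \<and> 1 \<le> q}.
         scl ((-1) ^ ((r + 1) * (q - 1))) (\<delta> (p + r + 1) \<boxtimes>\<^bsub>p + 1\<^esub> \<mu> q)) +
      (\<Sum>(q, r) \<in> {(q, r). q + r = n \<and> 1 \<le> q}.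
         scl ((-1) ^ (r * (q - 1))) (\<mu> (r + 1) \<boxtimes>\<^bsub>1\<^esub> \<delta> q)) +
      (\<Sum>(p, q, r) \<in> {(p, q, r). p + q + r = n \<and> 1 \<le> q \<and> 1 \<le> p}.
         scl ((-1) ^ (r * (q - 1))) (\<mu> (p + r + 1) \<boxtimes>\<^bsub>p + 1\<^esub> h q))"
\<comment> \<open>The witnesses are \<open>dual_elem GM\<close>, \<open>dual_elem GH\<close> and
  \<open>dual_elem GD\<close>, in this order; the label left open here is settled by the facts shown
  below.\<close>
proof (intro exI[of _ "dual_elem _"] allI impI conjI)
  fix n :: nat assume n: "1 \<le> n"
  show "distinct [dual_elem GM n, dual_elem GH n, dual_elem GD n :: _ \<Rightarrow>\<^sub>0 'k]"
    "scl.independent {dual_elem GM n, dual_elem GH n, dual_elem GD n :: _ \<Rightarrow>\<^sub>0 'k}"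
    using dual_elem_basis[OF n, where 'k = 'k] by blast+
  show "koszul_dual agd n = scl.span {dual_elem GM n, dual_elem GH n, dual_elem GD n :: _ \<Rightarrow>\<^sub>0 'k}"
    using koszul_dual_agd_eq[OF n, where 'k = 'k] by (simp add: dual_span_def)
  show "homogeneous sdeg (int n - 1) (dual_elem GM n :: _ \<Rightarrow>\<^sub>0 'k)"
    "homogeneous sdeg (int n) (dual_elem GH n :: _ \<Rightarrow>\<^sub>0 'k)"
    "homogeneous sdeg (int n) (dual_elem GD n :: _ \<Rightarrow>\<^sub>0 'k)"
    using homogeneous_dual_elem[of n GM] homogeneous_dual_elem[of n GH] homogeneous_dual_elem[of n GD]
    by simp_all
  show "counit (dual_elem GM n) = (if n = 1 then 1 else 0 :: 'k)"
    "counit (dual_elem GH n) = (0 :: 'k)" "counit (dual_elem GD n) = (0 :: 'k)"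
    by (simp_all add: counit_dual_elem)
qed (rule inf_decomp_mu inf_decomp_h inf_decomp_delta)+

end
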